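(* Let $G_2$ be the exceptional compact Lie group $G_2$, equipped with a bi-invariant Riemannian metric, and let $\rho:G_2\to\mathrm{Aut}(\mathbb{C}^7)$ be its standard representation. For $a,b\in\mathbb{C}^7$ define $\phi_{ab}:G_2\to\mathbb{C}$ by $\phi_{ab}(g)=\langle\rho(g)a,b\rangle$, where $\langle\cdot,\cdot\rangle$ is the complex-bilinear extension to $\mathbb{C}^7$ of the standard scalar product on $\mathbb{R}^7$. Suppose $p\in\mathbb{C}^7$ satisfies $\langle p,p\rangle=0$. Then $\mathcal{E}_p=\{\phi_{ap}\mid a\in\mathbb{C}^7\}$ is an eigenfamily on $G_2$, i.e. there exist $\lambda,\mu\in\mathbb{R}$ such that $$\Delta(\phi)=\lambda\phi\quad\text{and}\quad\kappa(\phi,\psi)=\mu\,\phi\psi$$ for all $\phi,\psi\in\mathcal{E}_p$.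
   Context: For a Riemannian manifold $(M,g)$ and smooth functions $\phi,\psi:M\to\mathbb{C}$, the Laplacian is $\Delta(\phi)=\mathrm{div}(\mathrm{grad}(\phi))$ and the conformality operator is $\kappa(\phi,\psi)=g(\mathrm{grad}(\phi),\mathrm{grad}(\psi))$, where $g$ is extended complex-bilinearly to the complexified tangent bundle (so $\kappa$ is complex bilinear). A seven-dimensional cross product on a $7$-dimensional Euclidean space $V$ is a skew-symmetric bilinear map $\times:V\times V\to V$ with $\langle u\times v,u\rangle=0$ and $|u\times v|^2=|u|^2|v|^2-\langle u,v\rangle^2$ for all $u,v\in V$. The compact group $G_2$ is $\{g\in SO(7)\mid g(v\times w)=(gv)\times(gw)\text{ for all }v,w\in\mathbb{R}^7\}$, and its standard representation is its inclusion in $SO(7)$ acting on $\mathbb{R}^7$, extended complex-linearly to $\mathbb{C}^7$. *)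

theory Defs
  imports "HOL-Analysis.Analysis"
begin

section \<open>Smooth maps\<close>

text \<open>\<open>C\<^sup>k\<close> maps on an open set \<open>U\<close>: all iterated directional derivatives up to order \<open>k\<close> exist
  as Frechet derivatives and are continuous.\<close>

fun Ck_on :: "nat \<Rightarrow> 'a::real_normed_vector set \<Rightarrow> ('a \<Rightarrow> 'b::real_normed_vector) \<Rightarrow> bool" where
  "Ck_on 0 U f \<longleftrightarrow> continuous_on U f"
| "Ck_on (Suc k) U f \<longleftrightarrow> (\<forall>x\<in>U. f differentiable at x) \<and>
     (\<forall>v. Ck_on k U (\<lambda>x. frechet_derivative f (at x) v))"

definition smooth_on :: "'a::real_normed_vector set \<Rightarrow> ('a \<Rightarrow> 'b::real_normed_vector) \<Rightarrow> bool" where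
  "smooth_on U f \<longleftrightarrow> (\<forall>k. Ck_on k U f)"


section \<open>Embedded Riemannian manifolds\<close>

text \<open>Throughout, \<open>M\<close> is the point set of an embedded smooth submanifold of a Euclidean space \<open>'a\<close>,
  tangent vectors are vectors of \<open>'a\<close>, and tensor and vector fields are functions on all of
  \<open>'a\<close> of which only the values at points of \<open>M\<close> (and, for a metric, on tangent vectors) matter.
  The metric is arbitrary; it need not be induced from the inner product of \<open>'a\<close>.\<close>

text \<open>Smooth maps on \<open>M\<close> are those with smooth local extensions to the ambient space.\<close>

definition smooth_map :: "'a::euclidean_space set \<Rightarrow> ('a \<Rightarrow> 'b::real_normed_vector) \<Rightarrow> bool" where
  "smooth_map M f \<longleftrightarrow> (\<forall>p\<in>M. \<exists>U F. open U \<and> p \<in> U \<and> smooth_on U F \<and> (\<forall>x\<in>U \<inter> M. F x = f x))"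

definition smooth_curve_at ::
    "'a::euclidean_space set \<Rightarrow> 'a \<Rightarrow> 'a \<Rightarrow> (real \<Rightarrow> 'a) \<Rightarrow> bool" where
  "smooth_curve_at M p v c \<longleftrightarrow> c 0 = p \<and> (c has_vector_derivative v) (at 0) \<and>
     (\<exists>e>0. smooth_on {-e<..<e} c \<and> c ` {-e<..<e} \<subseteq> M)"

definition tangent_space :: "'a::euclidean_space set \<Rightarrow> 'a \<Rightarrow> 'a set" where
  "tangent_space M p = {v. \<exists>c. smooth_curve_at M p v c}"

text \<open>The derivative of \<open>f\<close> at \<open>p\<close> in direction \<open>v \<in> T\<^sub>pM\<close>; it only depends on \<open>f\<close> on \<open>M\<close>.\<close>

definition dir_deriv ::
    "'a::euclidean_space set \<Rightarrow> ('a \<Rightarrow> 'b::real_normed_vector) \<Rightarrow> 'a \<Rightarrow> 'a \<Rightarrow> 'b" where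
  "dir_deriv M f p v =
     (THE d. \<forall>c. smooth_curve_at M p v c \<longrightarrow> ((f \<circ> c) has_vector_derivative d) (at 0))"

definition vector_field :: "'a::euclidean_space set \<Rightarrow> ('a \<Rightarrow> 'a) \<Rightarrow> bool" where
  "vector_field M X \<longleftrightarrow> smooth_map M X \<and> (\<forall>p\<in>M. X p \<in> tangent_space M p)"

text \<open>For vector fields tangent to an embedded submanifold, the Lie bracket is the difference of the
  directional derivatives taken in the ambient space.\<close>

definition lie_bracket ::
    "'a::euclidean_space set \<Rightarrow> ('a \<Rightarrow> 'a) \<Rightarrow> ('a \<Rightarrow> 'a) \<Rightarrow> 'a \<Rightarrow> 'a" where
  "lie_bracket M X Y p = dir_deriv M Y p (X p) - dir_deriv M X p (Y p)"

definition riemannian_metric ::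
    "'a::euclidean_space set \<Rightarrow> ('a \<Rightarrow> 'a \<Rightarrow> 'a \<Rightarrow> real) \<Rightarrow> bool" where
  "riemannian_metric M g \<longleftrightarrow>
     (\<forall>p\<in>M. \<forall>u\<in>tangent_space M p. \<forall>v\<in>tangent_space M p.
        g p u v = g p v u \<and>
        (\<forall>w\<in>tangent_space M p. \<forall>a b. g p (a *\<^sub>R u + b *\<^sub>R v) w = a * g p u w + b * g p v w) \<and>
        (u \<noteq> 0 \<longrightarrow> 0 < g p u u)) \<and>
     (\<forall>X Y. vector_field M X \<longrightarrow> vector_field M Y \<longrightarrow> smooth_map M (\<lambda>p. g p (X p) (Y p)))"

text \<open>\<open>D p v Y\<close> is the covariant derivative of the vector field \<open>Y\<close> at \<open>p\<close> in direction
  \<open>v \<in> T\<^sub>pM\<close>.\<close>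

definition is_levi_civita ::
    "'a::euclidean_space set \<Rightarrow> ('a \<Rightarrow> 'a \<Rightarrow> 'a \<Rightarrow> real) \<Rightarrow>
     ('a \<Rightarrow> 'a \<Rightarrow> ('a \<Rightarrow> 'a) \<Rightarrow> 'a) \<Rightarrow> bool" where
  "is_levi_civita M g D \<longleftrightarrow>
     (\<forall>X Y. vector_field M X \<longrightarrow> vector_field M Y \<longrightarrow> vector_field M (\<lambda>p. D p (X p) Y)) \<and>
     (\<forall>Y. vector_field M Y \<longrightarrow> (\<forall>p\<in>M. \<forall>u\<in>tangent_space M p. \<forall>v\<in>tangent_space M p. \<forall>a b.
        D p (a *\<^sub>R u + b *\<^sub>R v) Y = a *\<^sub>R D p u Y + b *\<^sub>R D p v Y)) \<and>
     (\<forall>Y Z. vector_field M Y \<longrightarrow> vector_field M Z \<longrightarrow> (\<forall>p\<in>M. \<forall>v\<in>tangent_space M p.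
        D p v (\<lambda>x. Y x + Z x) = D p v Y + D p v Z)) \<and>
     (\<forall>f Y. smooth_map M f \<longrightarrow> vector_field M Y \<longrightarrow> (\<forall>p\<in>M. \<forall>v\<in>tangent_space M p.
        D p v (\<lambda>x. f x *\<^sub>R Y x) = dir_deriv M f p v *\<^sub>R Y p + f p *\<^sub>R D p v Y)) \<and>
     (\<forall>X Y. vector_field M X \<longrightarrow> vector_field M Y \<longrightarrow> (\<forall>p\<in>M.
        D p (X p) Y - D p (Y p) X = lie_bracket M X Y p)) \<and>
     (\<forall>Y Z. vector_field M Y \<longrightarrow> vector_field M Z \<longrightarrow> (\<forall>p\<in>M. \<forall>v\<in>tangent_space M p.
        dir_deriv M (\<lambda>x. g x (Y x) (Z x)) p v = g p (D p v Y) (Z p) + g p (Y p) (D p v Z)))"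

text \<open>By the fundamental theorem of Riemannian geometry the choice below is unique at points of
  \<open>M\<close>, on tangent vectors and on smooth vector fields.\<close>

definition levi_civita ::
    "'a::euclidean_space set \<Rightarrow> ('a \<Rightarrow> 'a \<Rightarrow> 'a \<Rightarrow> real) \<Rightarrow> 'a \<Rightarrow> 'a \<Rightarrow> ('a \<Rightarrow> 'a) \<Rightarrow> 'a" where
  "levi_civita M g = (SOME D. is_levi_civita M g D)"

definition orthonormal_basis_at ::
    "'a::euclidean_space set \<Rightarrow> ('a \<Rightarrow> 'a \<Rightarrow> 'a \<Rightarrow> real) \<Rightarrow> 'a \<Rightarrow> 'a set \<Rightarrow> bool" where
  "orthonormal_basis_at M g p B \<longleftrightarrow> span B = tangent_space M p \<and>
     (\<forall>u\<in>B. \<forall>v\<in>B. g p u v = (if u = v then 1 else 0))"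

definition gradient ::
    "'a::euclidean_space set \<Rightarrow> ('a \<Rightarrow> 'a \<Rightarrow> 'a \<Rightarrow> real) \<Rightarrow> ('a \<Rightarrow> real) \<Rightarrow> 'a \<Rightarrow> 'a" where
  "gradient M g f p =
     (THE v. v \<in> tangent_space M p \<and> (\<forall>w\<in>tangent_space M p. g p v w = dir_deriv M f p w))"

text \<open>The divergence of \<open>X\<close> is the trace of the endomorphism \<open>v \<mapsto> \<nabla>\<^sub>vX\<close> of \<open>T\<^sub>pM\<close>, computed in an
  orthonormal basis (the choice of which is immaterial).\<close>

definition divergence ::
    "'a::euclidean_space set \<Rightarrow> ('a \<Rightarrow> 'a \<Rightarrow> 'a \<Rightarrow> real) \<Rightarrow> ('a \<Rightarrow> 'a) \<Rightarrow> 'a \<Rightarrow> real" where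
  "divergence M g X p =
     (\<Sum>e\<in>(SOME B. orthonormal_basis_at M g p B). g p (levi_civita M g p e X) e)"


section \<open>Complex-valued functions\<close>

text \<open>A pair \<open>(u, v)\<close> represents the vector \<open>u + \<i>v\<close> of the complexified tangent space; the metric
  is extended complex-bilinearly, gradient and divergence complex-linearly.\<close>

definition cmetric :: "('a \<Rightarrow> 'a \<Rightarrow> 'a \<Rightarrow> real) \<Rightarrow> 'a \<Rightarrow> 'a \<times> 'a \<Rightarrow> 'a \<times> 'a \<Rightarrow> complex" where
  "cmetric g p Z W =
     Complex (g p (fst Z) (fst W) - g p (snd Z) (snd W)) (g p (fst Z) (snd W) + g p (snd Z) (fst W))"

definition cgradient ::
    "'a::euclidean_space set \<Rightarrow> ('a \<Rightarrow> 'a \<Rightarrow> 'a \<Rightarrow> real) \<Rightarrow> ('a \<Rightarrow> complex) \<Rightarrow> 'a \<Rightarrow> 'a \<times> 'a" where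
  "cgradient M g \<phi> p = (gradient M g (\<lambda>x. Re (\<phi> x)) p, gradient M g (\<lambda>x. Im (\<phi> x)) p)"

definition cdivergence ::
    "'a::euclidean_space set \<Rightarrow> ('a \<Rightarrow> 'a \<Rightarrow> 'a \<Rightarrow> real) \<Rightarrow> ('a \<Rightarrow> 'a \<times> 'a) \<Rightarrow> 'a \<Rightarrow> complex" where
  "cdivergence M g Z p =
     Complex (divergence M g (\<lambda>x. fst (Z x)) p) (divergence M g (\<lambda>x. snd (Z x)) p)"

definition laplacian ::
    "'a::euclidean_space set \<Rightarrow> ('a \<Rightarrow> 'a \<Rightarrow> 'a \<Rightarrow> real) \<Rightarrow> ('a \<Rightarrow> complex) \<Rightarrow> 'a \<Rightarrow> complex" where
  "laplacian M g \<phi> = cdivergence M g (cgradient M g \<phi>)"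

definition conformality ::
    "'a::euclidean_space set \<Rightarrow> ('a \<Rightarrow> 'a \<Rightarrow> 'a \<Rightarrow> real) \<Rightarrow>
     ('a \<Rightarrow> complex) \<Rightarrow> ('a \<Rightarrow> complex) \<Rightarrow> 'a \<Rightarrow> complex" where
  "conformality M g \<phi> \<psi> p = cmetric g p (cgradient M g \<phi> p) (cgradient M g \<psi> p)"

definition eigenfamily ::
    "'a::euclidean_space set \<Rightarrow> ('a \<Rightarrow> 'a \<Rightarrow> 'a \<Rightarrow> real) \<Rightarrow> ('a \<Rightarrow> complex) set \<Rightarrow> bool" where
  "eigenfamily M g E \<longleftrightarrow> (\<forall>\<phi>\<in>E. smooth_map M \<phi>) \<and>
     (\<exists>lam mu :: real. \<forall>\<phi>\<in>E. \<forall>\<psi>\<in>E. \<forall>x\<in>M.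
        laplacian M g \<phi> x = of_real lam * \<phi> x \<and>
        conformality M g \<phi> \<psi> x = of_real mu * \<phi> x * \<psi> x)"


section \<open>The group G2 and its standard representation\<close>

definition cross_product7 :: "(real^7 \<Rightarrow> real^7 \<Rightarrow> real^7) \<Rightarrow> bool" where
  "cross_product7 X \<longleftrightarrow> bilinear X \<and> (\<forall>u v. X u v = - X v u) \<and> (\<forall>u v. X u v \<bullet> u = 0) \<and>
     (\<forall>u v. (norm (X u v))\<^sup>2 = (norm u)\<^sup>2 * (norm v)\<^sup>2 - (u \<bullet> v)\<^sup>2)"

definition G2 :: "(real^7 \<Rightarrow> real^7 \<Rightarrow> real^7) \<Rightarrow> (real^7^7) set" where
  "G2 X = {A. orthogonal_matrix A \<and> det A = 1 \<and> (\<forall>v w. A *v X v w = X (A *v v) (A *v w))}"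

text \<open>Translations by group elements are restrictions of linear maps of the ambient matrix space, so
  their differentials are again multiplication by the same matrix.\<close>

definition bi_invariant ::
    "(real^'n^'n) set \<Rightarrow> (real^'n^'n \<Rightarrow> real^'n^'n \<Rightarrow> real^'n^'n \<Rightarrow> real) \<Rightarrow> bool" where
  "bi_invariant G g \<longleftrightarrow>
     (\<forall>h\<in>G. \<forall>x\<in>G. \<forall>u\<in>tangent_space G x. \<forall>v\<in>tangent_space G x.
        g (h ** x) (h ** u) (h ** v) = g x u v \<and> g (x ** h) (u ** h) (v ** h) = g x u v)"

text \<open>The complex-linear extension to \<open>\<complex>\<^sup>n\<close> of the action of a real matrix on \<open>\<real>\<^sup>n\<close>.\<close>

definition rho :: "real^'n^'n \<Rightarrow> complex^'n \<Rightarrow> complex^'n" where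
  "rho A a = (\<chi> i j. complex_of_real (A $ i $ j)) *v a"

text \<open>Complex bilinear, without conjugation, unlike an inner product on \<open>\<complex>\<^sup>n\<close>.\<close>

definition cbilin :: "complex^'n \<Rightarrow> complex^'n \<Rightarrow> complex" where
  "cbilin a b = (\<Sum>i\<in>UNIV. a $ i * b $ i)"

definition phi :: "complex^'n \<Rightarrow> complex^'n \<Rightarrow> real^'n^'n \<Rightarrow> complex" where
  "phi a b A = cbilin (rho A a) b"

end

theory Submission
  imports Defs
begin

text \<open>The functions \<open>\<phi>\<^sub>a\<^sub>p\<close> are restrictions of real-linear functions on the space of matrices. For a
  bi-invariant metric on a group \<open>G\<close> of orthogonal matrices with Lie algebra \<open>\<g>\<close> and orthonormal
  basis \<open>B\<close> of \<open>\<g>\<close>, such functions satisfy \<open>\<Delta>\<phi>(x) = \<Sum>\<^bsub>E\<in>B\<^esub> \<phi>(x E E)\<close> and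
  \<open>\<kappa>(\<phi>, \<psi>)(x) = \<Sum>\<^bsub>E\<in>B\<^esub> \<phi>(x E) \<psi>(x E)\<close>. Neither the dimension of \<open>\<g>\<^sub>2\<close> nor its simplicity is needed
  to evaluate these sums: the form \<open>Q(a, q) = \<Sum>\<^bsub>E\<in>B\<^esub> \<langle>E a, q\<rangle>\<^sup>2\<close> is \<open>G\<^sub>2\<close>-invariant and vanishes for
  \<open>a = q\<close>. Involutions attached to quaternionic subalgebras of the octonions show that it is constant on
  orthonormal pairs, whence \<open>Q(a, q) = c (|a|\<^sup>2 |q|\<^sup>2 - \<langle>a, q\<rangle>\<^sup>2)\<close>. Polarising and extending to complex
  vectors gives \<open>\<lambda> = - 6 c\<close>, and \<open>\<mu> = - c\<close> for isotropic \<open>p\<close>.\<close>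

section \<open>Calculus of smooth maps\<close>

text \<open>The analytic half is shaped by the definitions: \<open>levi_civita\<close> and the basis
  in \<open>divergence\<close> are choices, \<open>gradient\<close> is unspecified off the group,
  and a tangent vector is merely the velocity of a curve. An explicit connection is therefore built
  to show that the choice is not void; afterwards only the axioms of a connection are used. As the
  Laplacian is a trace, the derivative of a left-invariant field E in direction A matters only
  through its component along A. Vanishing torsion and the invariance of the metric force this
  component to be 0, so only the second derivative \<open>F (x ** E ** E)\<close> survives.

  In the algebraic half, an involution that fixes a and u and negates r preserves the sum of
  <Ea,u><Ea,r>, by invariance, and also reverses its sign. With (u + r)/sqrt 2 and u - r in place of
  u and r, this reads Q(a,u) = Q(a,r). Seven dimensions leave room for a unit vector r orthogonal to
  two quaternionic triples that share a, which links all u orthogonal to a. The factor 6 is 7 - 1,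
  from the trace of the form. For isotropic p the term with <p,p> drops out and a pure product
  remains.\<close>

lemma Ck_on_cong:
  assumes "open U" "\<And>x. x \<in> U \<Longrightarrow> f x = h x"
  shows "Ck_on k U f \<longleftrightarrow> Ck_on k U h"
  using assms(2)
proof (induction k arbitrary: f h)
  case 0
  then show ?case by (simp cong: continuous_on_cong)
next
  case (Suc k)
  have *: "f1 differentiable at x \<Longrightarrow> f2 differentiable at x"
    if "x \<in> U" "\<And>x. x \<in> U \<Longrightarrow> f1 x = f2 x" for f1 f2 :: "'a \<Rightarrow> 'b" and x
    by (metis that assms(1) differentiable_def has_derivative_transform_within_open)
  have diff: "f differentiable at x \<longleftrightarrow> h differentiable at x" if "x \<in> U" for x
    using *[of x f h] *[of x h f] that Suc.prems by auto
  have "frechet_derivative f (at x) v = frechet_derivative h (at x) v"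
    if "x \<in> U" "f differentiable at x" for x v
    using frechet_derivative_transform_within_open[OF that(2) assms(1) that(1)] Suc.prems by auto
  then show ?case
    using Suc.IH[of "\<lambda>x. frechet_derivative f (at x) v" "\<lambda>x. frechet_derivative h (at x) v" for v]
    by (auto simp: diff)
qed

lemma Ck_on_subset: "Ck_on k U f \<Longrightarrow> V \<subseteq> U \<Longrightarrow> Ck_on k V f"
  by (induction k arbitrary: f) (auto intro: continuous_on_subset)

lemma Ck_on_SucD: "Ck_on (Suc k) U f \<Longrightarrow> Ck_on k U f"
  by (induction k arbitrary: f)
    (auto intro!: continuous_at_imp_continuous_on differentiable_imp_continuous_within)

text \<open>The induction step of the closure properties below: an explicit derivative
  \<open>F\<close> stands in for \<open>frechet_derivative\<close>, which agrees with it on the open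
  set by uniqueness.\<close>

lemma Ck_on_SucI:
  assumes "open U" "\<And>x. x \<in> U \<Longrightarrow> (f has_derivative F x) (at x)" "\<And>v. Ck_on k U (\<lambda>x. F x v)"
  shows "Ck_on (Suc k) U f"
proof -
  have "frechet_derivative f (at x) = F x" if "x \<in> U" for x
    using frechet_derivative_at[OF assms(2)[OF that]] by simp
  then have "Ck_on k U (\<lambda>x. frechet_derivative f (at x) v)" for v
    using assms(3)[of v] by (subst Ck_on_cong[OF assms(1), of _ "\<lambda>x. F x v"]) auto
  with assms(2) show ?thesis
    by (auto simp: differentiable_def)
qed

lemma Ck_on_derivative:
  assumes "Ck_on (Suc k) U f" "x \<in> U"
  shows "(f has_derivative frechet_derivative f (at x)) (at x)"
  using assms frechet_derivative_works[of f "at x"] by auto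

lemma Ck_on_const: "Ck_on k U (\<lambda>x. c)"
  by (induction k arbitrary: c) auto

lemma Ck_on_linear:
  assumes "open U" "bounded_linear f"
  shows "Ck_on k U f"
proof (cases k)
  case 0
  then show ?thesis
    by (simp add: assms(2) linear_continuous_on)
next
  case (Suc n)
  then show ?thesis
    using Ck_on_SucI[OF assms(1), of f "\<lambda>x. f"] Ck_on_const
      bounded_linear.has_derivative[OF assms(2) has_derivative_ident] by auto
qed

lemma Ck_on_bounded_linear:
  assumes "open U" "Ck_on k U f" "bounded_linear h"
  shows "Ck_on k U (\<lambda>x. h (f x))"
  using assms(2)
proof (induction k arbitrary: f)
  case 0
  then show ?case
    using bounded_linear.continuous_on[OF assms(3)] by auto
next
  case (Suc k)
  have "Ck_on k U (\<lambda>x. frechet_derivative f (at x) v)" for v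
    using Suc.prems by simp
  from Suc.IH[OF this] show ?case
    using bounded_linear.has_derivative[OF assms(3) Ck_on_derivative[OF Suc.prems]]
    by (intro Ck_on_SucI[OF assms(1)])
qed

lemma Ck_on_add:
  assumes "open U" "Ck_on k U f" "Ck_on k U h"
  shows "Ck_on k U (\<lambda>x. f x + h x)"
  using assms(2,3)
proof (induction k arbitrary: f h)
  case 0
  then show ?case by (auto intro: continuous_on_add)
next
  case (Suc k)
  have "Ck_on k U (\<lambda>x. frechet_derivative f (at x) v)" "Ck_on k U (\<lambda>x. frechet_derivative h (at x) v)" for v
    using Suc.prems by simp_all
  from Suc.IH[OF this] show ?case
    using has_derivative_add[OF Ck_on_derivative[OF Suc.prems(1)] Ck_on_derivative[OF Suc.prems(2)]]
    by (intro Ck_on_SucI[OF assms(1)])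
qed

lemma Ck_on_bilinear:
  assumes "open U" "bounded_bilinear m" "Ck_on k U f" "Ck_on k U h"
  shows "Ck_on k U (\<lambda>x. m (f x) (h x))"
  using assms(3,4)
proof (induction k arbitrary: f h)
  case 0
  then show ?case
    using bounded_bilinear.continuous_on[OF assms(2)] by auto
next
  case (Suc k)
  have 1: "Ck_on k U (\<lambda>x. frechet_derivative f (at x) v)" "Ck_on k U (\<lambda>x. frechet_derivative h (at x) v)" for v
    using Suc.prems by simp_all
  \<comment> \<open>Each term of the product rule keeps one factor undifferentiated; that factor
    must be lowered to order \<open>k\<close> before the induction hypothesis applies.\<close>
  have 2: "Ck_on k U f" "Ck_on k U h"
    using Suc.prems Ck_on_SucD by blast+
  have "Ck_on k U (\<lambda>x. m (f x) (frechet_derivative h (at x) v) + m (frechet_derivative f (at x) v) (h x))" for v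
    by (intro Ck_on_add[OF assms(1)] Suc.IH 1 2)
  then show ?case
    using bounded_bilinear.FDERIV[OF assms(2) Ck_on_derivative[OF Suc.prems(1)] Ck_on_derivative[OF Suc.prems(2)]]
    by (intro Ck_on_SucI[OF assms(1)])
qed

lemma Ck_on_sum:
  assumes "open U" "\<And>i. i \<in> I \<Longrightarrow> Ck_on k U (f i)"
  shows "Ck_on k U (\<lambda>x. \<Sum>i\<in>I. f i x)"
  using assms(2) by (induction I rule: infinite_finite_induct) (auto intro: Ck_on_const Ck_on_add[OF assms(1)])

lemma Ck_on_precompose_linear:
  assumes "open V" "bounded_linear L" "L ` V \<subseteq> U" "Ck_on k U f"
  shows "Ck_on k V (\<lambda>x. f (L x))"
  using assms(4)
proof (induction k arbitrary: f)
  case 0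
  then show ?case
    using continuous_on_compose2[OF _ linear_continuous_on[OF assms(2)]] assms(3) by auto
next
  case (Suc k)
  have "Ck_on k U (\<lambda>x. frechet_derivative f (at x) (L v))" for v
    using Suc.prems by simp
  then have "Ck_on k V (\<lambda>x. frechet_derivative f (at (L x)) (L v))" for v
    by (rule Suc.IH)
  moreover have "((\<lambda>x. f (L x)) has_derivative (\<lambda>v. frechet_derivative f (at (L x)) (L v))) (at x)"
    if "x \<in> V" for x
    using has_derivative_compose[OF bounded_linear_imp_has_derivative[OF assms(2)]
        Ck_on_derivative[OF Suc.prems]] that assms(3) by blast
  ultimately show ?case
    by (intro Ck_on_SucI[OF assms(1)])
qed

text \<open>\<open>Ck_on\<close> speaks of constant directions only. A direction varying with the
  point is expanded in \<open>Basis\<close>, which leaves products of smooth coefficients with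
  derivatives in constant directions.\<close>

lemma smooth_on_directional_derivative:
  fixes f :: "'a::euclidean_space \<Rightarrow> 'b::real_normed_vector"
  assumes "open U" "smooth_on U f" "smooth_on U w"
  shows "smooth_on U (\<lambda>x. frechet_derivative f (at x) (w x))"
  unfolding smooth_on_def
proof
  fix k
  have f: "Ck_on (Suc k) U f" and w: "Ck_on k U w"
    using assms(2,3) unfolding smooth_on_def by blast+
  have eq: "frechet_derivative f (at x) (w x) =
      (\<Sum>b\<in>Basis. (w x \<bullet> b) *\<^sub>R frechet_derivative f (at x) b)" if "x \<in> U" for x
  proof -
    have "linear (frechet_derivative f (at x))"
      using f that by (auto intro: linear_frechet_derivative)
    then show ?thesis
      by (subst euclidean_representation[of "w x", symmetric])
        (simp add: linear_sum linear_cmul)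
  qed
  have "Ck_on k U (\<lambda>x. (w x \<bullet> b) *\<^sub>R frechet_derivative f (at x) b)" for b
    using f by (intro Ck_on_bilinear[OF assms(1) bounded_bilinear_scaleR]
        Ck_on_bounded_linear[OF assms(1) w] bounded_linear_inner_left) auto
  then show "Ck_on k U (\<lambda>x. frechet_derivative f (at x) (w x))"
    by (subst Ck_on_cong[OF assms(1) eq]) (auto intro: Ck_on_sum[OF assms(1)])
qed

lemma smooth_on_linear: "open U \<Longrightarrow> bounded_linear f \<Longrightarrow> smooth_on U f"
  by (simp add: smooth_on_def Ck_on_linear)

lemma smooth_on_const: "smooth_on U (\<lambda>x. c)"
  by (simp add: smooth_on_def Ck_on_const)

lemma smooth_on_subset: "smooth_on U f \<Longrightarrow> V \<subseteq> U \<Longrightarrow> smooth_on V f"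
  by (auto simp: smooth_on_def intro: Ck_on_subset)

lemma smooth_on_bilinear:
  "open U \<Longrightarrow> bounded_bilinear m \<Longrightarrow> smooth_on U f \<Longrightarrow> smooth_on U h \<Longrightarrow>
    smooth_on U (\<lambda>x. m (f x) (h x))"
  by (simp add: smooth_on_def Ck_on_bilinear)

lemma smooth_on_add:
  "open U \<Longrightarrow> smooth_on U f \<Longrightarrow> smooth_on U h \<Longrightarrow> smooth_on U (\<lambda>x. f x + h x)"
  by (simp add: smooth_on_def Ck_on_add)

lemma smooth_on_bounded_linear:
  "open U \<Longrightarrow> smooth_on U f \<Longrightarrow> bounded_linear h \<Longrightarrow> smooth_on U (\<lambda>x. h (f x))"
  by (simp add: smooth_on_def Ck_on_bounded_linear)

lemma smooth_mapD:
  assumes "smooth_map M f" "p \<in> M"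
  shows "\<exists>U F. open U \<and> p \<in> U \<and> smooth_on U F \<and> (\<forall>x\<in>U \<inter> M. F x = f x)"
  using assms unfolding smooth_map_def by blast

lemma smooth_map_cong:
  "(\<And>x. x \<in> M \<Longrightarrow> f x = h x) \<Longrightarrow> smooth_map M f \<longleftrightarrow> smooth_map M h"
  unfolding smooth_map_def by fastforce

lemma smooth_map_linear: "bounded_linear f \<Longrightarrow> smooth_map M f"
  unfolding smooth_map_def using open_UNIV smooth_on_linear by blast

lemma smooth_map_const: "smooth_map M (\<lambda>x. c)"
  unfolding smooth_map_def using open_UNIV smooth_on_const by blast

lemma smooth_map_bilinear:
  assumes "bounded_bilinear m" "smooth_map M f" "smooth_map M h"
  shows "smooth_map M (\<lambda>x. m (f x) (h x))"
  unfolding smooth_map_def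
proof
  fix p assume p: "p \<in> M"
  obtain U F where F: "open U" "p \<in> U" "smooth_on U F" "\<And>x. x \<in> U \<inter> M \<Longrightarrow> F x = f x"
    using smooth_mapD[OF assms(2) p] by blast
  obtain V H where H: "open V" "p \<in> V" "smooth_on V H" "\<And>x. x \<in> V \<inter> M \<Longrightarrow> H x = h x"
    using smooth_mapD[OF assms(3) p] by blast
  show "\<exists>U F. open U \<and> p \<in> U \<and> smooth_on U F \<and> (\<forall>x\<in>U \<inter> M. F x = m (f x) (h x))"
    using F H smooth_on_subset[OF F(3), of "U \<inter> V"] smooth_on_subset[OF H(3), of "U \<inter> V"]
    by (intro exI[of _ "U \<inter> V"] exI[of _ "\<lambda>x. m (F x) (H x)"])
      (auto intro: smooth_on_bilinear[OF _ assms(1)])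
qed

lemma smooth_map_bounded_linear:
  assumes "bounded_linear h" "smooth_map M f"
  shows "smooth_map M (\<lambda>x. h (f x))"
  unfolding smooth_map_def
proof
  fix p assume p: "p \<in> M"
  obtain U F where F: "open U" "p \<in> U" "smooth_on U F" "\<And>x. x \<in> U \<inter> M \<Longrightarrow> F x = f x"
    using smooth_mapD[OF assms(2) p] by blast
  then show "\<exists>U F. open U \<and> p \<in> U \<and> smooth_on U F \<and> (\<forall>x\<in>U \<inter> M. F x = h (f x))"
    using smooth_on_bounded_linear[OF F(1,3) assms(1)]
    by (intro exI[of _ U] exI[of _ "\<lambda>x. h (F x)"]) auto
qed

lemma smooth_map_add:
  assumes "smooth_map M f" "smooth_map M h"
  shows "smooth_map M (\<lambda>x. f x + h x)"
  unfolding smooth_map_def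
proof
  fix p assume p: "p \<in> M"
  obtain U F where F: "open U" "p \<in> U" "smooth_on U F" "\<And>x. x \<in> U \<inter> M \<Longrightarrow> F x = f x"
    using smooth_mapD[OF assms(1) p] by blast
  obtain V H where H: "open V" "p \<in> V" "smooth_on V H" "\<And>x. x \<in> V \<inter> M \<Longrightarrow> H x = h x"
    using smooth_mapD[OF assms(2) p] by blast
  show "\<exists>U F. open U \<and> p \<in> U \<and> smooth_on U F \<and> (\<forall>x\<in>U \<inter> M. F x = f x + h x)"
    using F H smooth_on_subset[OF F(3), of "U \<inter> V"] smooth_on_subset[OF H(3), of "U \<inter> V"]
    by (intro exI[of _ "U \<inter> V"] exI[of _ "\<lambda>x. F x + H x"])
      (auto intro: smooth_on_add)
qed

lemma smooth_map_sum:
  assumes "\<And>i. i \<in> I \<Longrightarrow> smooth_map M (f i)"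
  shows "smooth_map M (\<lambda>x. \<Sum>i\<in>I. f i x)"
  using assms
proof (induction I rule: infinite_finite_induct)
  case (insert i I)
  then show ?case
    using smooth_map_add[of M "f i" "\<lambda>x. \<Sum>i\<in>I. f i x"] by simp
qed (simp_all add: smooth_map_const)

section \<open>Directional derivatives\<close>

text \<open>Near 0 the curve stays in \<open>U \<inter> M\<close>, where \<open>F\<close> and
  \<open>f\<close> agree, so the chain rule for \<open>F\<close> applies. All curves with velocity
  \<open>v\<close> thus give the same value, which makes the \<open>THE\<close> in
  \<open>dir_deriv\<close> meaningful.\<close>

lemma smooth_curve_at_compose:
  assumes c: "smooth_curve_at M p v c" and F: "(F has_derivative F') (at p)"
    and U: "open U" "p \<in> U" "\<And>x. x \<in> U \<inter> M \<Longrightarrow> F x = f x"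
  shows "((f \<circ> c) has_vector_derivative F' v) (at 0)"
proof -
  obtain e where e: "e > 0" "c ` {-e<..<e} \<subseteq> M" and c0: "c 0 = p"
      and cv: "(c has_vector_derivative v) (at 0)"
    using c unfolding smooth_curve_at_def by blast
  have "((\<lambda>t. F (c t)) has_vector_derivative F' v) (at 0)"
  proof -
    have lin: "linear F'"
      using F has_derivative_linear by blast
    have "((\<lambda>t. F (c t)) has_derivative (\<lambda>t. F' (t *\<^sub>R v))) (at 0)"
      using has_derivative_compose[of c "\<lambda>t. t *\<^sub>R v" 0 UNIV F F'] cv F c0
      unfolding has_vector_derivative_def by simp
    then show ?thesis
      unfolding has_vector_derivative_def by (simp add: linear_cmul[OF lin])
  qed
  moreover obtain S where S: "open S" "0 \<in> S" "\<And>t. t \<in> S \<Longrightarrow> F (c t) = (f \<circ> c) t"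
  proof -
    have "(c \<longlongrightarrow> c 0) (nhds 0)"
      using has_vector_derivative_continuous[OF cv]
      unfolding isCont_def tendsto_at_iff_tendsto_nhds .
    then have "eventually (\<lambda>t. c t \<in> U) (nhds 0)"
      using topological_tendstoD[of c "c 0" "nhds 0" U] U(1,2) c0 by simp
    moreover have "eventually (\<lambda>t::real. t \<in> {-e<..<e}) (nhds 0)"
      by (rule eventually_nhds_in_open) (use e(1) in auto)
    ultimately have "eventually (\<lambda>t. F (c t) = (f \<circ> c) t) (nhds 0)"
    proof eventually_elim
      case (elim t)
      then have "c t \<in> U \<inter> M"
        using e(2) by blast
      then show ?case
        using U(3) by simp
    qed
    then show thesis
      unfolding eventually_nhds by (auto intro: that)
  qed
  ultimately show ?thesis
    by (rule has_vector_derivative_transform_within_open)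
qed

text \<open>Tangency of \<open>v\<close> supplies at least one curve; without a curve every
  \<open>d\<close> would satisfy the condition under the \<open>THE\<close>.\<close>

lemma dir_deriv_unique:
  assumes "v \<in> tangent_space M p"
    and "\<And>c. smooth_curve_at M p v c \<Longrightarrow> ((f \<circ> c) has_vector_derivative d) (at 0)"
  shows "dir_deriv M f p v = d"
  unfolding dir_deriv_def
proof (rule the_equality)
  show "\<forall>c. smooth_curve_at M p v c \<longrightarrow> ((f \<circ> c) has_vector_derivative d) (at 0)"
    using assms(2) by blast
next
  fix d' assume "\<forall>c. smooth_curve_at M p v c \<longrightarrow> ((f \<circ> c) has_vector_derivative d') (at 0)"
  moreover obtain c where "smooth_curve_at M p v c"
    using assms(1) unfolding tangent_space_def by blast
  ultimately show "d' = d"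
    using assms(2) vector_derivative_unique_at by blast
qed

lemma dir_deriv_eq:
  assumes "v \<in> tangent_space M p" "(F has_derivative F') (at p)"
    and "open U" "p \<in> U" "\<And>x. x \<in> U \<inter> M \<Longrightarrow> F x = f x"
  shows "dir_deriv M f p v = F' v"
  by (rule dir_deriv_unique[OF assms(1)], rule smooth_curve_at_compose[OF _ assms(2-5)])

lemma smooth_map_derivative:
  assumes "smooth_map M f" "p \<in> M"
  obtains F' where "bounded_linear F'"
    "\<And>v c. smooth_curve_at M p v c \<Longrightarrow> ((f \<circ> c) has_vector_derivative F' v) (at 0)"
    "\<And>v. v \<in> tangent_space M p \<Longrightarrow> dir_deriv M f p v = F' v"
proof -
  obtain U F where F: "open U" "p \<in> U" "smooth_on U F" "\<And>x. x \<in> U \<inter> M \<Longrightarrow> F x = f x"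
    using smooth_mapD[OF assms] by blast
  have F': "(F has_derivative frechet_derivative F (at p)) (at p)"
    using F(2,3) Ck_on_derivative unfolding smooth_on_def by blast
  have eq: "F x = f x" if "x \<in> U \<inter> M" for x
    using F(4) that by blast
  show thesis
    by (rule that[OF has_derivative_bounded_linear[OF F']
          smooth_curve_at_compose[OF _ F' F(1,2) eq] dir_deriv_eq[OF _ F' F(1,2) eq]])
qed

lemma dir_deriv_curve:
  assumes "smooth_map M f" "p \<in> M" "smooth_curve_at M p v c"
  shows "((f \<circ> c) has_vector_derivative dir_deriv M f p v) (at 0)"
proof -
  have v: "v \<in> tangent_space M p"
    using assms(3) by (auto simp: tangent_space_def)
  show ?thesis
    by (rule smooth_map_derivative[OF assms(1,2)]) (use assms(3) v in simp)
qed

text \<open>Curves run inside \<open>M\<close>, so the two predicates under the \<open>THE\<close>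
  coincide.\<close>

lemma dir_deriv_cong:
  assumes "p \<in> M" "\<And>x. x \<in> M \<Longrightarrow> f x = h x"
  shows "dir_deriv M f p v = dir_deriv M h p v"
proof -
  have 1: "((h \<circ> c) has_vector_derivative d) (at 0)"
    if c: "smooth_curve_at M p v c" and d: "((f \<circ> c) has_vector_derivative d) (at 0)"
      and eq: "\<And>x. x \<in> M \<Longrightarrow> f x = h x" for c d and f h :: "'a \<Rightarrow> 'b"
  proof -
    obtain e where e: "e > 0" "c ` {-e<..<e} \<subseteq> M"
      using c unfolding smooth_curve_at_def by blast
    have S: "0 \<in> {-e<..<e}"
      using e by auto
    have "(f \<circ> c) t = (h \<circ> c) t" if "t \<in> {-e<..<e}" for t
      using e(2) that by (auto intro!: eq)
    then show ?thesis
      using has_vector_derivative_transform_within_open[OF d open_greaterThanLessThan S] by blast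
  qed
  show ?thesis
    unfolding dir_deriv_def
    by (intro arg_cong[where f = The] ext) (use 1[of _ f _ h] 1[of _ h _ f] assms(2) in auto)
qed

lemma dir_deriv_bilinear:
  assumes m: "bounded_bilinear m" and "smooth_map M f" "smooth_map M h" "p \<in> M" "v \<in> tangent_space M p"
  shows "dir_deriv M (\<lambda>x. m (f x) (h x)) p v =
    m (f p) (dir_deriv M h p v) + m (dir_deriv M f p v) (h p)"
proof (rule dir_deriv_unique[OF assms(5)])
  fix c assume c: "smooth_curve_at M p v c"
  then have "c 0 = p"
    by (simp add: smooth_curve_at_def)
  then show "((\<lambda>x. m (f x) (h x)) \<circ> c has_vector_derivative
      m (f p) (dir_deriv M h p v) + m (dir_deriv M f p v) (h p)) (at 0)"
    using bounded_bilinear.has_vector_derivative[OF m dir_deriv_curve[OF assms(2,4) c] dir_deriv_curve[OF assms(3,4) c]]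
    by (simp add: o_def)
qed

lemma dir_deriv_add:
  assumes "smooth_map M f" "smooth_map M h" "p \<in> M" "v \<in> tangent_space M p"
  shows "dir_deriv M (\<lambda>x. f x + h x) p v = dir_deriv M f p v + dir_deriv M h p v"
proof (rule dir_deriv_unique[OF assms(4)])
  fix c assume c: "smooth_curve_at M p v c"
  show "((\<lambda>x. f x + h x) \<circ> c has_vector_derivative dir_deriv M f p v + dir_deriv M h p v) (at 0)"
    using has_vector_derivative_add[OF dir_deriv_curve[OF assms(1,3) c] dir_deriv_curve[OF assms(2,3) c]]
    by (simp add: o_def)
qed

lemma dir_deriv_linear:
  assumes "bounded_linear f" "v \<in> tangent_space M p"
  shows "dir_deriv M f p v = f v"
  using dir_deriv_eq[OF assms(2) bounded_linear_imp_has_derivative[OF assms(1)] open_UNIV] by auto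

text \<open>Membership of the combination is assumed because \<open>tangent_space\<close> need not
  be a subspace for a general set \<open>M\<close>.\<close>

lemma dir_deriv_combination:
  assumes "smooth_map M f" "p \<in> M" "u \<in> tangent_space M p" "v \<in> tangent_space M p"
    "a *\<^sub>R u + b *\<^sub>R v \<in> tangent_space M p"
  shows "dir_deriv M f p (a *\<^sub>R u + b *\<^sub>R v) = a *\<^sub>R dir_deriv M f p u + b *\<^sub>R dir_deriv M f p v"
proof -
  obtain F' where F': "bounded_linear F'" "\<forall>v\<in>tangent_space M p. dir_deriv M f p v = F' v"
    by (rule smooth_map_derivative[OF assms(1,2)]) blast
  show ?thesis
    using F' assms(3-5) by (simp add: linear_simps)
qed

lemma smooth_map_dir_deriv:
  assumes "smooth_map M f" "vector_field M X"
  shows "smooth_map M (\<lambda>x. dir_deriv M f x (X x))"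
  unfolding smooth_map_def
proof
  fix p assume p: "p \<in> M"
  have X: "smooth_map M X"
    using assms(2) by (simp add: vector_field_def)
  obtain U F where F: "open U" "p \<in> U" "smooth_on U F" "\<And>x. x \<in> U \<inter> M \<Longrightarrow> F x = f x"
    using smooth_mapD[OF assms(1) p] by blast
  obtain V H where H: "open V" "p \<in> V" "smooth_on V H" "\<And>x. x \<in> V \<inter> M \<Longrightarrow> H x = X x"
    using smooth_mapD[OF X p] by blast
  have "frechet_derivative F (at x) (H x) = dir_deriv M f x (X x)" if "x \<in> U \<inter> V \<inter> M" for x
  proof -
    have "(F has_derivative frechet_derivative F (at x)) (at x)"
      using F(3) that unfolding smooth_on_def by (metis Ck_on_derivative IntD1)
    then show ?thesis
      using dir_deriv_eq[of "X x" M x F _ U f] assms(2) F(1,4) H(4) that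
      by (simp add: vector_field_def)
  qed
  moreover have "smooth_on (U \<inter> V) (\<lambda>x. frechet_derivative F (at x) (H x))"
    using smooth_on_subset[OF F(3), of "U \<inter> V"] smooth_on_subset[OF H(3), of "U \<inter> V"] F(1) H(1)
    by (intro smooth_on_directional_derivative) auto
  moreover have "open (U \<inter> V)" "p \<in> U \<inter> V"
    using F H by auto
  ultimately show "\<exists>U F. open U \<and> p \<in> U \<and> smooth_on U F \<and> (\<forall>x\<in>U \<inter> M. F x = dir_deriv M f x (X x))"
    by blast
qed

section \<open>Orthonormal bases for bilinear forms\<close>

text \<open>The counterpart of \<open>orthonormal_basis_at\<close> for one fixed form. Finiteness is
  included so that a sum over \<open>B\<close> is never the default value 0 of an infinite
  sum.\<close>

definition ortho_basis :: "('a::euclidean_space \<Rightarrow> 'a \<Rightarrow> real) \<Rightarrow> 'a set \<Rightarrow> 'a set \<Rightarrow> bool" where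
  "ortho_basis \<beta> S B \<longleftrightarrow> finite B \<and> span B = S \<and> (\<forall>u\<in>B. \<forall>v\<in>B. \<beta> u v = (if u = v then 1 else 0))"

lemma ortho_basis_subset: "ortho_basis \<beta> S B \<Longrightarrow> B \<subseteq> S"
  using span_superset unfolding ortho_basis_def by blast

lemma orthonormal_sum:
  assumes "bounded_bilinear \<beta>" "finite B" "\<And>u v. u \<in> B \<Longrightarrow> v \<in> B \<Longrightarrow> \<beta> u v = (if u = v then 1 else (0::real))" "v \<in> B"
  shows "\<beta> (\<Sum>u\<in>B. r u *\<^sub>R u) v = r v"
proof -
  interpret bounded_bilinear \<beta> by fact
  have "\<beta> (\<Sum>u\<in>B. r u *\<^sub>R u) v = (\<Sum>u\<in>B. r u * \<beta> u v)"
    by (simp add: sum_left scaleR_left)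
  also have "\<dots> = (\<Sum>u\<in>B. if v = u then r u else 0)"
    by (intro sum.cong) (use assms(3,4) in auto)
  finally show ?thesis
    using assms(2,4) by (simp add: sum.delta')
qed

lemma orthonormal_independent:
  fixes \<beta> :: "'a::euclidean_space \<Rightarrow> 'a \<Rightarrow> real"
  assumes "bounded_bilinear \<beta>" "\<And>u v. u \<in> B \<Longrightarrow> v \<in> B \<Longrightarrow> \<beta> u v = (if u = v then 1 else 0)"
  shows "independent B"
  unfolding independent_explicit_finite_subsets
proof (intro allI impI ballI)
  fix A r v
  assume A: "A \<subseteq> B" "finite A" "(\<Sum>u\<in>A. r u *\<^sub>R u) = 0" "v \<in> A"
  have "r v = \<beta> (\<Sum>u\<in>A. r u *\<^sub>R u) v"
    using orthonormal_sum[OF assms(1) A(2) _ A(4), of r] assms(2) A(1) by (simp add: subset_iff)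
  then show "r v = 0"
    using A(3) bounded_bilinear.zero_left[OF assms(1)] by simp
qed

lemma ortho_basis_expand:
  assumes "bounded_bilinear \<beta>" "ortho_basis \<beta> S B" "u \<in> S"
  shows "(\<Sum>E\<in>B. \<beta> u E *\<^sub>R E) = u"
proof -
  obtain r where "u = (\<Sum>E\<in>B. r E *\<^sub>R E)"
    using assms(2,3) unfolding ortho_basis_def by (auto simp: span_finite)
  then show ?thesis
    using orthonormal_sum[OF assms(1), of B _ r] assms(2) unfolding ortho_basis_def by simp
qed

text \<open>The sum is the trace of \<open>W\<close> with respect to \<open>\<beta>\<close>.
  Expanding one argument over \<open>B\<close>, swapping the sums and collecting over
  \<open>C\<close> in the other argument passes from one basis to the other. This serves both for
  the chosen basis in \<open>divergence\<close> and for conjugation invariance.\<close>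

lemma ortho_basis_trace:
  fixes W :: "'a::euclidean_space \<Rightarrow> 'a \<Rightarrow> 'b::real_normed_vector"
  assumes "bounded_bilinear \<beta>" "\<And>u v. u \<in> S \<Longrightarrow> v \<in> S \<Longrightarrow> \<beta> u v = \<beta> v u"
    and B: "ortho_basis \<beta> S B" and C: "ortho_basis \<beta> S C" and "bounded_bilinear W"
  shows "(\<Sum>E\<in>C. W E E) = (\<Sum>E\<in>B. W E E)"
proof -
  interpret W: bounded_bilinear W by fact
  have sub: "B \<subseteq> S" "C \<subseteq> S"
    using B C span_superset unfolding ortho_basis_def by blast+
  have "(\<Sum>E\<in>C. W E E) = (\<Sum>E\<in>C. W E (\<Sum>F\<in>B. \<beta> E F *\<^sub>R F))"
    using ortho_basis_expand[OF assms(1) B] sub by (intro sum.cong) auto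
  also have "\<dots> = (\<Sum>F\<in>B. \<Sum>E\<in>C. \<beta> E F *\<^sub>R W E F)"
    by (subst sum.swap) (simp add: W.sum_right W.scaleR_right)
  also have "\<dots> = (\<Sum>F\<in>B. W (\<Sum>E\<in>C. \<beta> F E *\<^sub>R E) F)"
    using assms(2) sub by (intro sum.cong) (auto simp: W.sum_left W.scaleR_left subset_iff intro!: sum.cong)
  also have "\<dots> = (\<Sum>F\<in>B. W F F)"
    using ortho_basis_expand[OF assms(1) C] sub by (intro sum.cong) auto
  finally show ?thesis .
qed

text \<open>A maximal orthonormal subset is taken; its size is bounded since orthonormal sets are
  independent. A vector outside its span, minus its projection and normalised, would enlarge
  it.\<close>

lemma ortho_basis_exists:
  assumes \<beta>: "bounded_bilinear \<beta>" and S: "subspace S"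
    and sym: "\<And>u v. u \<in> S \<Longrightarrow> v \<in> S \<Longrightarrow> \<beta> u v = \<beta> v u"
    and pos: "\<And>u. u \<in> S \<Longrightarrow> u \<noteq> 0 \<Longrightarrow> \<beta> u u > 0"
  shows "\<exists>B. ortho_basis \<beta> S B"
proof -
  interpret \<beta>: bounded_bilinear \<beta> by fact
  define ON where "ON B \<longleftrightarrow> finite B \<and> B \<subseteq> S \<and> (\<forall>u\<in>B. \<forall>v\<in>B. \<beta> u v = (if u = v then 1 else 0))" for B
  have "card B \<le> DIM('a)" if "ON B" for B
    using that independent_bound[OF orthonormal_independent[OF \<beta>, of B]] unfolding ON_def by auto
  moreover have "ON {}"
    by (simp add: ON_def)
  ultimately obtain B where B: "ON B" and max: "\<And>C. ON C \<Longrightarrow> card C \<le> card B"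
    using ex_has_greatest_nat[of ON "{}" card "DIM('a) + 1"] by (auto simp: less_Suc_eq_le)
  have "u \<in> span B" if u: "u \<in> S" for u
  proof (rule ccontr)
    assume "u \<notin> span B"
    define w where "w = u - (\<Sum>E\<in>B. \<beta> u E *\<^sub>R E)"
    have "(\<Sum>E\<in>B. \<beta> u E *\<^sub>R E) \<in> span B"
      by (intro span_sum span_scale span_base)
    then have "w \<noteq> 0"
      using \<open>u \<notin> span B\<close> by (auto simp: w_def)
    have "w \<in> S"
      unfolding w_def using B u S
      by (auto simp: ON_def intro!: subspace_diff subspace_sum subspace_scale)
    have orth: "\<beta> w v = 0" if "v \<in> B" for v
      using orthonormal_sum[OF \<beta>, of B v "\<beta> u"] B that by (simp add: w_def \<beta>.diff_left ON_def)
    define e where "e = (1 / sqrt (\<beta> w w)) *\<^sub>R w"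
    have ww: "\<beta> w w > 0"
      using pos \<open>w \<in> S\<close> \<open>w \<noteq> 0\<close> by blast
    have ee: "\<beta> e e = 1"
      using ww by (simp add: e_def \<beta>.scaleR_left \<beta>.scaleR_right)
    have ev: "\<beta> e v = 0" "\<beta> v e = 0" if "v \<in> B" for v
      using orth[OF that] sym[of v w] B that \<open>w \<in> S\<close>
      by (auto simp: e_def \<beta>.scaleR_left \<beta>.scaleR_right ON_def)
    have "e \<notin> B"
      using ee ev by force
    have "e \<in> S"
      using \<open>w \<in> S\<close> S by (simp add: e_def subspace_scale)
    then have "ON (insert e B)"
      using B ee ev \<open>e \<notin> B\<close> by (auto simp: ON_def)
    from max[OF this] show False
      using B \<open>e \<notin> B\<close> by (simp add: ON_def)
  qed
  then have "span B = S"
    using B S span_minimal unfolding ON_def by blast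
  then show ?thesis
    using B unfolding ON_def ortho_basis_def by blast
qed

section \<open>Tangent spaces\<close>

lemma zero_in_tangent_space: "p \<in> M \<Longrightarrow> 0 \<in> tangent_space M p"
  unfolding tangent_space_def smooth_curve_at_def
  by (auto intro!: exI[of _ "\<lambda>t. p"] exI[of _ "1::real"] smooth_on_const)

text \<open>Product rule for the product of two curves. For matrix multiplication at the identity of
  a group it yields sums of tangent vectors.\<close>

lemma tangent_space_bilinear:
  assumes m: "bounded_bilinear m" and mK: "\<And>x y. x \<in> M \<Longrightarrow> y \<in> N \<Longrightarrow> m x y \<in> K"
    and "v \<in> tangent_space M p" "w \<in> tangent_space N q"
  shows "m p w + m v q \<in> tangent_space K (m p q)"
proof -
  obtain c e where c: "c 0 = p" "(c has_vector_derivative v) (at 0)" "e > 0"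
      "smooth_on {-e<..<e} c" "c ` {-e<..<e} \<subseteq> M"
    using assms(3) unfolding tangent_space_def smooth_curve_at_def by blast
  obtain d r where d: "d 0 = q" "(d has_vector_derivative w) (at 0)" "r > 0"
      "smooth_on {-r<..<r} d" "d ` {-r<..<r} \<subseteq> N"
    using assms(4) unfolding tangent_space_def smooth_curve_at_def by blast
  define s where "s = min e r"
  have sub: "{-s<..<s} \<subseteq> {-e<..<e}" "{-s<..<s} \<subseteq> {-r<..<r}"
    by (auto simp: s_def)
  have "smooth_on {-s<..<s} (\<lambda>t. m (c t) (d t))"
    by (intro smooth_on_bilinear[OF _ m] smooth_on_subset[OF c(4) sub(1)] smooth_on_subset[OF d(4) sub(2)]) auto
  moreover have "m (c t) (d t) \<in> K" if "t \<in> {-s<..<s}" for t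
    using mK c(5) d(5) sub that by blast
  moreover have "((\<lambda>t. m (c t) (d t)) has_vector_derivative m p w + m v q) (at 0)"
    using bounded_bilinear.has_vector_derivative[OF m c(2) d(2)] c(1) d(1) by simp
  moreover have "s > 0"
    using c(3) d(3) by (simp add: s_def)
  ultimately have "smooth_curve_at K (m p q) (m p w + m v q) (\<lambda>t. m (c t) (d t))"
    unfolding smooth_curve_at_def using c(1) d(1) by blast
  then show ?thesis
    unfolding tangent_space_def by blast
qed

lemma tangent_space_linear:
  assumes L: "bounded_linear L" and LN: "\<And>x. x \<in> M \<Longrightarrow> L x \<in> N" and "v \<in> tangent_space M p"
  shows "L v \<in> tangent_space N (L p)"
proof -
  obtain c e where c: "c 0 = p" "(c has_vector_derivative v) (at 0)" "e > 0"
      "smooth_on {-e<..<e} c" "c ` {-e<..<e} \<subseteq> M"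
    using assms(3) unfolding tangent_space_def smooth_curve_at_def by blast
  have "smooth_on {-e<..<e} (\<lambda>t. L (c t))"
    by (rule smooth_on_bounded_linear[OF _ c(4) L]) simp
  moreover have "(\<lambda>t. L (c t)) ` {-e<..<e} \<subseteq> N"
    using c(5) by (auto simp: image_subset_iff intro!: LN)
  ultimately have "smooth_curve_at N (L p) (L v) (\<lambda>t. L (c t))"
    unfolding smooth_curve_at_def
    using c(1,3) bounded_linear.has_vector_derivative[OF L c(2)] by (intro conjI exI[of _ e]) simp_all
  then show ?thesis
    unfolding tangent_space_def by blast
qed

lemma tangent_space_scaleR:
  assumes "v \<in> tangent_space M p"
  shows "a *\<^sub>R v \<in> tangent_space M p"
proof -
  obtain c e where c: "c 0 = p" "(c has_vector_derivative v) (at 0)" "e > 0"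
      "smooth_on {-e<..<e} c" "c ` {-e<..<e} \<subseteq> M"
    using assms unfolding tangent_space_def smooth_curve_at_def by blast
  \<comment> \<open>The summand 1 covers \<open>a = 0\<close> and makes
    \<open>\<bar>a\<bar> * s < e\<close> strict.\<close>
  define s where "s = e / (\<bar>a\<bar> + 1)"
  have s: "s > 0" "\<bar>a\<bar> * s < e"
    using c(3) by (auto simp: s_def field_simps)
  have img: "a * t \<in> {-e<..<e}" if "t \<in> {-s<..<s}" for t
  proof -
    have "\<bar>a * t\<bar> \<le> \<bar>a\<bar> * s"
      using that by (auto simp: abs_mult intro!: mult_left_mono)
    then show ?thesis
      using s by auto
  qed
  have "smooth_on {-s<..<s} (\<lambda>t. c (a * t))"
    unfolding smooth_on_def
  proof
    fix k
    have "Ck_on k {-e<..<e} c"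
      using c(4) by (simp add: smooth_on_def)
    then show "Ck_on k {-s<..<s} (\<lambda>t. c (a * t))"
      using img by (intro Ck_on_precompose_linear[OF _ bounded_linear_mult_right, where U = "{-e<..<e}"]) (auto simp: image_subset_iff)
  qed
  moreover have "(\<lambda>t. c (a * t)) ` {-s<..<s} \<subseteq> M"
    using c(5) img by blast
  moreover have "((\<lambda>t. c (a * t)) has_vector_derivative a *\<^sub>R v) (at 0)"
  proof -
    have "((\<lambda>t. a * t) has_vector_derivative a) (at 0)"
      unfolding has_real_derivative_iff_has_vector_derivative[symmetric]
      by (rule DERIV_cmult_Id)
    from vector_diff_chain_at[OF this, of c v] show ?thesis
      using c(2) by (simp add: o_def)
  qed
  ultimately have "smooth_curve_at M p (a *\<^sub>R v) (\<lambda>t. c (a * t))"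
    unfolding smooth_curve_at_def using c(1) s(1) by (intro conjI exI[of _ s]) simp_all
  then show ?thesis
    unfolding tangent_space_def by blast
qed

lemma subspace_projection:
  fixes S :: "'a::euclidean_space set"
  assumes "subspace S"
  obtains P where "bounded_linear P" "\<And>x. P x \<in> S" "\<And>x. x \<in> S \<Longrightarrow> P x = x"
proof -
  have "\<exists>P. P ` UNIV \<subseteq> S \<and> linear P \<and> (\<forall>v\<in>S. P (id v) = v)"
    using linear_exists_left_inverse_on[of id S] assms by (simp add: linear_id)
  then show thesis
    using that by (auto simp: linear_conv_bounded_linear image_subset_iff)
qed

text \<open>A projection \<open>P\<close> onto \<open>S\<close> fixes \<open>f\<close> on \<open>M\<close>, hence also fixes its derivative.\<close>

lemma dir_deriv_in_subspace:
  fixes f :: "'a::euclidean_space \<Rightarrow> 'b::euclidean_space"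
  assumes "smooth_map M f" "p \<in> M" "v \<in> tangent_space M p" "subspace S" "\<And>x. x \<in> M \<Longrightarrow> f x \<in> S"
  shows "dir_deriv M f p v \<in> S"
proof -
  obtain P where P: "bounded_linear P" "\<And>x. P x \<in> S" "\<And>x. x \<in> S \<Longrightarrow> P x = x"
    using subspace_projection[OF assms(4)] by blast
  have "dir_deriv M (\<lambda>x. P (f x)) p v = P (dir_deriv M f p v)"
  proof (rule dir_deriv_unique[OF assms(3)])
    fix c assume "smooth_curve_at M p v c"
    from bounded_linear.has_vector_derivative[OF P(1) dir_deriv_curve[OF assms(1,2) this]]
    show "((\<lambda>x. P (f x)) \<circ> c has_vector_derivative P (dir_deriv M f p v)) (at 0)"
      by (simp add: o_def)
  qed
  moreover have "dir_deriv M (\<lambda>x. P (f x)) p v = dir_deriv M f p v"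
    using P(3) assms(5) by (intro dir_deriv_cong[OF assms(2)]) auto
  ultimately show ?thesis
    using P(2) by metis
qed

lemma dir_deriv_const:
  assumes "v \<in> tangent_space M p"
  shows "dir_deriv M (\<lambda>x. c) p v = 0"
  using dir_deriv_eq[OF assms has_derivative_const[of c] open_UNIV] by simp

section \<open>Bilinear maps on matrix spaces\<close>

lemma bounded_bilinear_matrix_mult:
  "bounded_bilinear ((**) :: real^'n^'m \<Rightarrow> real^'k^'n \<Rightarrow> real^'k^'m)"
  unfolding bilinear_conv_bounded_bilinear[symmetric] bilinear_def
  by (auto intro!: linearI simp: vec_eq_iff matrix_matrix_mult_def sum.distrib sum_distrib_left algebra_simps)

interpretation mm: bounded_bilinear "(**) :: real^'n^'m \<Rightarrow> real^'k^'n \<Rightarrow> real^'k^'m"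
  by (rule bounded_bilinear_matrix_mult)

lemma bounded_linear_transpose: "bounded_linear (transpose :: real^'n^'m \<Rightarrow> real^'m^'n)"
  unfolding linear_conv_bounded_linear[symmetric]
  by (auto intro!: linearI simp: vec_eq_iff transpose_def)


text \<open>Conjugation by an orthogonal matrix, with its two occurrences separated so that the
  bilinear product rule can differentiate it.\<close>

lemma bounded_bilinear_conjugation:
  "bounded_bilinear (\<lambda>x y. x ** A ** transpose y :: real^'n^'n)" for A :: "real^'n^'n"
  by (intro bounded_bilinear.comp[OF bounded_bilinear_matrix_mult] mm.bounded_linear_left bounded_linear_transpose)

lemma bounded_bilinear_transpose_mult:
  "bounded_bilinear (\<lambda>x y. transpose x ** y :: real^'n^'n)"
  by (intro bounded_bilinear.comp[OF bounded_bilinear_matrix_mult] bounded_linear_ident bounded_linear_transpose)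

section \<open>Bi-invariant metrics on matrix groups\<close>

text \<open>Inverses are written as transposes because the elements are orthogonal. Every tangent
  space is a left translate of the one at \<open>mat 1\<close>, which is how linear structure is
  obtained from curves.\<close>

locale bi_invariant_group =
  fixes G :: "(real^'n^'n) set" and g :: "real^'n^'n \<Rightarrow> real^'n^'n \<Rightarrow> real^'n^'n \<Rightarrow> real"
  assumes one: "mat 1 \<in> G"
    and mult: "x \<in> G \<Longrightarrow> y \<in> G \<Longrightarrow> x ** y \<in> G"
    and inv: "x \<in> G \<Longrightarrow> transpose x \<in> G"
    and orth: "x \<in> G \<Longrightarrow> orthogonal_matrix x"
    and metric: "riemannian_metric G g"
    and biinv: "bi_invariant G g"
begin

abbreviation lie :: "(real^'n^'n) set" where
  "lie \<equiv> tangent_space G (mat 1)"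

lemma transpose_mult_self [simp]:
  assumes "x \<in> G"
  shows "transpose x ** x = mat 1" "x ** transpose x = mat 1"
  using orth[OF assms] by (auto simp: orthogonal_matrix_def)

lemma cancel_left [simp]:
  assumes "x \<in> G"
  shows "transpose x ** (x ** A) = A" "x ** (transpose x ** A) = A"
  using assms by (simp_all add: matrix_mul_assoc)

lemma cancel_right [simp]:
  assumes "x \<in> G"
  shows "A ** transpose x ** x = A" "A ** x ** transpose x = A"
  using assms by (simp_all flip: matrix_mul_assoc)

lemma tangent_left:
  assumes "x \<in> G" "v \<in> tangent_space G y"
  shows "x ** v \<in> tangent_space G (x ** y)"
  by (rule tangent_space_linear[OF mm.bounded_linear_right _ assms(2)]) (rule mult[OF assms(1)])

lemma tangent_left_iff:
  assumes "x \<in> G"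
  shows "v \<in> tangent_space G x \<longleftrightarrow> transpose x ** v \<in> lie"
proof
  show "transpose x ** v \<in> lie" if "v \<in> tangent_space G x"
    using tangent_left[OF inv[OF assms] that] assms by simp
  show "v \<in> tangent_space G x" if "transpose x ** v \<in> lie"
    using tangent_left[OF assms that] assms by simp
qed

lemma left_translate_tangent: "x \<in> G \<Longrightarrow> A \<in> lie \<Longrightarrow> x ** A \<in> tangent_space G x"
  by (simp add: tangent_left_iff)

text \<open>The product of two curves through the identity has the sum of their velocities as its
  velocity.\<close>

lemma subspace_lie: "subspace lie"
proof (rule subspaceI)
  show "0 \<in> lie"
    by (rule zero_in_tangent_space[OF one])
next
  fix A C assume "A \<in> lie" "C \<in> lie"
  then have "mat 1 ** C + A ** mat 1 \<in> tangent_space G (mat 1 ** mat 1)"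
    by (intro tangent_space_bilinear[OF bounded_bilinear_matrix_mult mult])
  then show "A + C \<in> lie"
    by (simp add: add.commute)
qed (rule tangent_space_scaleR)

lemma subspace_tangent_space:
  assumes "x \<in> G"
  shows "subspace (tangent_space G x)"
  using subspace_lie
  unfolding subspace_def
  by (simp add: tangent_left_iff[OF assms] mm.add_right mm.scaleR_right)

text \<open>Differentiate the constant function \<open>transpose x ** x\<close> at the
  identity.\<close>

lemma lie_skew:
  assumes "A \<in> lie"
  shows "transpose A = - A"
proof -
  have "dir_deriv G (\<lambda>x. transpose x ** x) (mat 1) A = dir_deriv G (\<lambda>x. mat 1) (mat 1) A"
    by (rule dir_deriv_cong[OF one]) simp
  moreover have "dir_deriv G (\<lambda>x. transpose x ** x) (mat 1) A = A + transpose A"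
    using dir_deriv_bilinear[OF bounded_bilinear_transpose_mult smooth_map_linear smooth_map_linear one assms,
        OF bounded_linear_ident bounded_linear_ident]
    by (simp add: dir_deriv_linear[OF bounded_linear_ident assms])
  ultimately have "A + transpose A = 0"
    using dir_deriv_const[OF assms] by simp
  then show ?thesis
    by (simp add: add_eq_0_iff)
qed

lemma lie_conjugate:
  assumes "h \<in> G" "A \<in> lie"
  shows "h ** A ** transpose h \<in> lie"
proof -
  have "bounded_linear (\<lambda>A. h ** A ** transpose h)"
    by (intro bounded_linear_compose[OF mm.bounded_linear_left] mm.bounded_linear_right)
  from tangent_space_linear[OF this _ assms(2), of G] show ?thesis
    using assms(1) by (simp add: mult inv)
qed

text \<open>The derivative of Ad at the identity is ad; skewness of \<open>C\<close> turns the
  second term into the other half of the commutator.\<close>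

lemma dir_deriv_conjugation:
  assumes "C \<in> lie"
  shows "dir_deriv G (\<lambda>h. h ** A ** transpose h) (mat 1) C = C ** A - A ** C"
  using dir_deriv_bilinear[OF bounded_bilinear_conjugation smooth_map_linear smooth_map_linear one assms,
      OF bounded_linear_ident bounded_linear_ident]
  by (simp add: dir_deriv_linear[OF bounded_linear_ident assms] lie_skew[OF assms] mm.minus_right)

lemma smooth_map_conjugation: "smooth_map G (\<lambda>h. h ** A ** transpose h)"
  by (intro smooth_map_bilinear[OF bounded_bilinear_conjugation] smooth_map_linear bounded_linear_ident)

text \<open>The bracket is the derivative of a conjugation that never leaves the subspace
  \<open>lie\<close>.\<close>

lemma lie_bracket_closed:
  assumes "A \<in> lie" "C \<in> lie"
  shows "C ** A - A ** C \<in> lie"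
  unfolding dir_deriv_conjugation[OF assms(2), symmetric]
  by (rule dir_deriv_in_subspace[OF smooth_map_conjugation one assms(2) subspace_lie lie_conjugate[OF _ assms(1)]])

text \<open>The metric at the identity is only meaningful on \<open>lie\<close>; composing it with a projection
  makes it bilinear on all matrices.\<close>

definition lie_proj :: "real^'n^'n \<Rightarrow> real^'n^'n" where
  "lie_proj = (SOME P. bounded_linear P \<and> (\<forall>x. P x \<in> lie) \<and> (\<forall>x\<in>lie. P x = x))"

lemma lie_proj: "bounded_linear lie_proj" "lie_proj x \<in> lie" "x \<in> lie \<Longrightarrow> lie_proj x = x"
proof -
  have "\<exists>P. bounded_linear P \<and> (\<forall>x. P x \<in> lie) \<and> (\<forall>x\<in>lie. P x = x)"
    using subspace_projection[OF subspace_lie] by metis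
  from someI_ex[OF this]
  show "bounded_linear lie_proj" "lie_proj x \<in> lie" "x \<in> lie \<Longrightarrow> lie_proj x = x"
    unfolding lie_proj_def by blast+
qed

definition ip :: "real^'n^'n \<Rightarrow> real^'n^'n \<Rightarrow> real" where
  "ip A C = g (mat 1) (lie_proj A) (lie_proj C)"

lemma metric_at:
  assumes "x \<in> G" "u \<in> tangent_space G x" "v \<in> tangent_space G x"
  shows "g x u v = g x v u \<and>
    (\<forall>w\<in>tangent_space G x. \<forall>a b. g x (a *\<^sub>R u + b *\<^sub>R v) w = a * g x u w + b * g x v w) \<and>
    (u \<noteq> 0 \<longrightarrow> 0 < g x u u)"
  using metric assms unfolding riemannian_metric_def by blast

lemma ip_sym: "ip A C = ip C A"
  using metric_at[OF one lie_proj(2)[of A] lie_proj(2)[of C]] by (simp add: ip_def)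

lemma bounded_bilinear_ip: "bounded_bilinear ip"
proof -
  have lin: "linear (\<lambda>A. ip A C)" for C
  proof (rule linearI)
    fix A A' and r :: real
    show "ip (A + A') C = ip A C + ip A' C"
      using metric_at[OF one lie_proj(2)[of A] lie_proj(2)[of A']] lie_proj(2)[of C]
      by (auto simp: ip_def linear_simps[OF lie_proj(1)] dest!: bspec spec[of _ "1::real"])
    show "ip (r *\<^sub>R A) C = r *\<^sub>R ip A C"
      using metric_at[OF one lie_proj(2)[of A] lie_proj(2)[of A]] lie_proj(2)[of C]
      by (auto simp: ip_def linear_simps[OF lie_proj(1)] dest!: bspec dest: spec[of _ r] spec[of _ "0::real"])
  qed
  then have "bilinear ip"
    unfolding bilinear_def using lin by (subst (asm) ip_sym) simp
  then show ?thesis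
    by (simp add: bilinear_conv_bounded_bilinear)
qed

sublocale ip: bounded_bilinear ip
  by (rule bounded_bilinear_ip)

lemma ip_pos: "A \<in> lie \<Longrightarrow> A \<noteq> 0 \<Longrightarrow> ip A A > 0"
  using metric_at[OF one, of A A] by (simp add: ip_def lie_proj)

lemma metric_left_translate:
  assumes "x \<in> G" "u \<in> tangent_space G x" "v \<in> tangent_space G x"
  shows "g x u v = ip (transpose x ** u) (transpose x ** v)"
proof -
  have "g (transpose x ** x) (transpose x ** u) (transpose x ** v) = g x u v"
    using biinv assms inv[OF assms(1)] unfolding bi_invariant_def by blast
  then show ?thesis
    using assms by (simp add: ip_def lie_proj tangent_left_iff)
qed

text \<open>Ad-invariance: left and right invariance of the metric combined.\<close>

lemma ip_conjugate:
  assumes "h \<in> G" "A \<in> lie" "C \<in> lie"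
  shows "ip (h ** A ** transpose h) (h ** C ** transpose h) = ip A C"
proof -
  have T: "h ** A \<in> tangent_space G h" "h ** C \<in> tangent_space G h"
    using assms by (auto simp: left_translate_tangent)
  then have "g (h ** transpose h) (h ** A ** transpose h) (h ** C ** transpose h) = g h (h ** A) (h ** C)"
    using biinv assms inv[OF assms(1)] unfolding bi_invariant_def by blast
  then show ?thesis
    using assms T by (simp add: ip_def lie_proj lie_conjugate metric_left_translate)
qed

text \<open>The derivative of Ad-invariance: ad \<open>E\<close> is skew for
  \<open>ip\<close>.\<close>

lemma ip_bracket:
  assumes A: "A \<in> lie" and C: "C \<in> lie" and E: "E \<in> lie"
  shows "ip (E ** A - A ** E) C + ip A (E ** C - C ** E) = 0"
proof -
  have "dir_deriv G (\<lambda>h. ip (h ** A ** transpose h) (h ** C ** transpose h)) (mat 1) E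
      = dir_deriv G (\<lambda>h. ip A C) (mat 1) E"
    by (rule dir_deriv_cong[OF one]) (simp add: ip_conjugate A C)
  then have "dir_deriv G (\<lambda>h. ip (h ** A ** transpose h) (h ** C ** transpose h)) (mat 1) E = 0"
    using dir_deriv_const[OF E] by simp
  then show ?thesis
    using dir_deriv_bilinear[OF bounded_bilinear_ip smooth_map_conjugation smooth_map_conjugation one E, of A C]
    by (simp add: dir_deriv_conjugation[OF E])
qed

lemma ip_bracket_self:
  assumes "A \<in> lie" "E \<in> lie"
  shows "ip (E ** A - A ** E) A = 0"
  using ip_bracket[OF assms(1) assms(1) assms(2)] ip_sym by simp

section \<open>The Levi-Civita connection of a bi-invariant metric\<close>

text \<open>In terms of the left trivialisation \<open>v = x \<xi>\<close>, \<open>Y = x \<eta>\<close> this is \<open>x (d\<eta>(v) + [\<xi>, \<eta>] / 2)\<close>.\<close>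

definition lc :: "real^'n^'n \<Rightarrow> real^'n^'n \<Rightarrow> (real^'n^'n \<Rightarrow> real^'n^'n) \<Rightarrow> real^'n^'n" where
  "lc p v Y = dir_deriv G Y p v - (1/2) *\<^sub>R (v ** transpose p ** Y p + Y p ** transpose p ** v)"

lemma smooth_map_left_trivialisation:
  fixes Y :: "real^'n^'n \<Rightarrow> real^'n^'n"
  assumes "smooth_map G Y"
  shows "smooth_map G (\<lambda>x. transpose x ** Y x)"
  by (rule smooth_map_bilinear[OF bounded_bilinear_transpose_mult smooth_map_linear[OF bounded_linear_ident] assms])

lemma vector_fieldD:
  assumes "vector_field G Y"
  shows "smooth_map G Y" "x \<in> G \<Longrightarrow> Y x \<in> tangent_space G x" "x \<in> G \<Longrightarrow> transpose x ** Y x \<in> lie"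
  using assms tangent_left_iff by (auto simp: vector_field_def)

text \<open>The symmetric correction in \<open>lc\<close> makes the torsion identity immediate. Here
  it becomes half a bracket: differentiating \<open>transpose x\<close> contributes
  \<open>- \<xi> \<eta>\<close>, and compensating for this changes the sign of one of the two
  products. Tangency and compatibility with the metric are read off from this form.\<close>

lemma lc_left_trivialisation:
  assumes "smooth_map G Y" "p \<in> G" "v \<in> tangent_space G p"
  shows "transpose p ** lc p v Y = dir_deriv G (\<lambda>x. transpose x ** Y x) p v +
    (1/2) *\<^sub>R (transpose p ** v ** (transpose p ** Y p) - transpose p ** Y p ** (transpose p ** v))"
proof -
  define \<xi> where "\<xi> = transpose p ** v"
  have v: "v = p ** \<xi>"
    using assms(2) by (simp add: \<xi>_def)
  have "transpose \<xi> = - \<xi>"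
    using lie_skew assms by (simp add: \<xi>_def tangent_left_iff)
  then have tv: "transpose v = - (\<xi> ** transpose p)"
    by (simp add: v matrix_transpose_mul mm.minus_left)
  have "dir_deriv G (\<lambda>x. transpose x ** Y x) p v = transpose p ** dir_deriv G Y p v + transpose v ** Y p"
    using dir_deriv_bilinear[OF bounded_bilinear_transpose_mult smooth_map_linear assms(1) assms(2,3), OF bounded_linear_ident]
    by (simp add: dir_deriv_linear[OF bounded_linear_ident assms(3)])
  moreover have "transpose p ** lc p v Y = transpose p ** dir_deriv G Y p v -
      (1/2) *\<^sub>R (\<xi> ** (transpose p ** Y p) + transpose p ** Y p ** \<xi>)"
    by (simp add: lc_def \<xi>_def mm.diff_right mm.add_right mm.scaleR_right matrix_mul_assoc)
  moreover have "D - (1/2) *\<^sub>R (A + C) = D - A + (1/2) *\<^sub>R (A - C)" for A C D :: "real^'n^'n"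
    by (simp add: vec_eq_iff field_simps)
  ultimately show ?thesis
    by (simp add: tv mm.minus_left flip: \<xi>_def matrix_mul_assoc)
qed

lemma lc_tangent:
  assumes "vector_field G Y" "p \<in> G" "v \<in> tangent_space G p"
  shows "lc p v Y \<in> tangent_space G p"
proof -
  have lie: "transpose p ** v \<in> lie" "transpose p ** Y p \<in> lie"
    using assms vector_fieldD[OF assms(1)] by (auto simp: tangent_left_iff)
  have "dir_deriv G (\<lambda>x. transpose x ** Y x) p v \<in> lie"
    using assms(2,3) vector_fieldD[OF assms(1)]
    by (intro dir_deriv_in_subspace[OF smooth_map_left_trivialisation _ _ subspace_lie]) auto
  then show ?thesis
    unfolding tangent_left_iff[OF assms(2)] lc_left_trivialisation[OF vector_fieldD(1)[OF assms(1)] assms(2,3)]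
    by (intro subspace_add[OF subspace_lie] subspace_scale[OF subspace_lie] lie_bracket_closed lie)
qed

lemma vector_field_lc:
  assumes "vector_field G X" "vector_field G Y"
  shows "vector_field G (\<lambda>p. lc p (X p) Y)"
proof -
  have *: "smooth_map G (\<lambda>p. A p ** transpose p ** C p)"
    if "smooth_map G A" "smooth_map G C" for A C :: "real^'n^'n \<Rightarrow> real^'n^'n"
    by (intro smooth_map_bilinear[OF bounded_bilinear_matrix_mult] that smooth_map_linear bounded_linear_transpose)
  have "smooth_map G (\<lambda>p. dir_deriv G Y p (X p) +
      (- (1/2)) *\<^sub>R (X p ** transpose p ** Y p + Y p ** transpose p ** X p))"
    using vector_fieldD(1)[OF assms(1)] vector_fieldD(1)[OF assms(2)] assms(1)
    by (intro smooth_map_add smooth_map_dir_deriv smooth_map_bounded_linear[OF bounded_linear_scaleR_right] *)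
  then have "smooth_map G (\<lambda>p. lc p (X p) Y)"
    by (simp add: lc_def)
  then show ?thesis
    using lc_tangent[OF assms(2)] vector_fieldD(2)[OF assms(1)] by (simp add: vector_field_def)
qed

lemma lc_metric:
  assumes "vector_field G Y" "vector_field G Z" "p \<in> G" "v \<in> tangent_space G p"
  shows "dir_deriv G (\<lambda>x. g x (Y x) (Z x)) p v = g p (lc p v Y) (Z p) + g p (Y p) (lc p v Z)"
proof -
  define \<xi> \<eta> \<zeta> where "\<xi> = transpose p ** v" and "\<eta> = transpose p ** Y p" and "\<zeta> = transpose p ** Z p"
  have lie: "\<xi> \<in> lie" "\<eta> \<in> lie" "\<zeta> \<in> lie"
    using assms vector_fieldD by (auto simp: \<xi>_def \<eta>_def \<zeta>_def tangent_left_iff)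
  have "dir_deriv G (\<lambda>x. g x (Y x) (Z x)) p v =
      dir_deriv G (\<lambda>x. ip (transpose x ** Y x) (transpose x ** Z x)) p v"
    by (rule dir_deriv_cong[OF assms(3)])
      (simp add: metric_left_translate vector_fieldD[OF assms(1)] vector_fieldD[OF assms(2)])
  also have "\<dots> = ip \<eta> (dir_deriv G (\<lambda>x. transpose x ** Z x) p v) + ip (dir_deriv G (\<lambda>x. transpose x ** Y x) p v) \<zeta>"
    unfolding \<eta>_def \<zeta>_def
    by (rule dir_deriv_bilinear[OF bounded_bilinear_ip smooth_map_left_trivialisation smooth_map_left_trivialisation assms(3,4)])
      (rule vector_fieldD(1)[OF assms(1)] vector_fieldD(1)[OF assms(2)])+
  \<comment> \<open>The two half brackets cancel, since ad \<open>\<xi>\<close> is skew for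
    \<open>ip\<close>.\<close>
  also have "\<dots> = ip (transpose p ** lc p v Y) \<zeta> + ip \<eta> (transpose p ** lc p v Z)"
    using ip_bracket[OF lie(2,3,1)] assms vector_fieldD
    by (simp add: lc_left_trivialisation ip.add_left ip.add_right ip.scaleR_left ip.scaleR_right
        flip: \<xi>_def \<eta>_def \<zeta>_def)
  finally show ?thesis
    using assms vector_fieldD lc_tangent by (simp add: metric_left_translate \<eta>_def \<zeta>_def)
qed

lemma is_levi_civita_lc: "is_levi_civita G g lc"
  unfolding is_levi_civita_def
proof (intro conjI allI impI ballI)
  fix X Y assume "vector_field G X" "vector_field G Y"
  then show "vector_field G (\<lambda>p. lc p (X p) Y)"
    by (rule vector_field_lc)
next
  fix Y p u v and a b :: real
  assume "vector_field G Y" "p \<in> G" "u \<in> tangent_space G p" "v \<in> tangent_space G p"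
  moreover from this have "a *\<^sub>R u + b *\<^sub>R v \<in> tangent_space G p"
    using subspace_tangent_space by (intro subspace_add subspace_scale)
  ultimately have "dir_deriv G Y p (a *\<^sub>R u + b *\<^sub>R v) = a *\<^sub>R dir_deriv G Y p u + b *\<^sub>R dir_deriv G Y p v"
    using vector_fieldD(1) by (intro dir_deriv_combination)
  then show "lc p (a *\<^sub>R u + b *\<^sub>R v) Y = a *\<^sub>R lc p u Y + b *\<^sub>R lc p v Y"
    by (simp add: lc_def mm.add_left mm.add_right mm.scaleR_left mm.scaleR_right algebra_simps)
next
  fix Y Z p v assume "vector_field G Y" "vector_field G Z" "p \<in> G" "v \<in> tangent_space G p"
  then show "lc p v (\<lambda>x. Y x + Z x) = lc p v Y + lc p v Z"
    by (simp add: lc_def dir_deriv_add vector_fieldD(1) mm.add_left mm.add_right algebra_simps)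
next
  fix f :: "real^'n^'n \<Rightarrow> real" and Y p v
  assume "smooth_map G f" "vector_field G Y" "p \<in> G" "v \<in> tangent_space G p"
  then show "lc p v (\<lambda>x. f x *\<^sub>R Y x) = dir_deriv G f p v *\<^sub>R Y p + f p *\<^sub>R lc p v Y"
    using dir_deriv_bilinear[OF bounded_bilinear_scaleR, of G f Y p v]
    by (simp add: lc_def vector_fieldD(1) mm.scaleR_left mm.scaleR_right algebra_simps)
next
  fix X Y p assume "vector_field G X" "vector_field G Y" "p \<in> G"
  show "lc p (X p) Y - lc p (Y p) X = lie_bracket G X Y p"
    by (simp add: lc_def lie_bracket_def algebra_simps)
next
  fix Y Z p v assume "vector_field G Y" "vector_field G Z" "p \<in> G" "v \<in> tangent_space G p"
  then show "dir_deriv G (\<lambda>x. g x (Y x) (Z x)) p v = g p (lc p v Y) (Z p) + g p (Y p) (lc p v Z)"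
    by (rule lc_metric)
qed

text \<open>The explicit \<open>lc\<close> serves to show that the choice in
  \<open>levi_civita\<close> is not void; from here on the chosen connection is accessed through its
  axioms.\<close>

lemma is_levi_civita: "is_levi_civita G g (levi_civita G g)"
  unfolding levi_civita_def by (rule someI[where P = "is_levi_civita G g", OF is_levi_civita_lc])

end

section \<open>Laplacian and conformality operator on linear functions\<close>

context bi_invariant_group
begin

text \<open>Expanding \<open>transpose x ** w\<close> in \<open>B\<close> verifies the defining
  property of the gradient; definiteness of the metric gives the uniqueness that \<open>THE\<close>
  requires.\<close>

lemma gradient_linear:
  assumes B: "ortho_basis ip lie B" and F: "bounded_linear F" and x: "x \<in> G"
  shows "gradient G g F x = x ** (\<Sum>E\<in>B. F (x ** E) *\<^sub>R E)"
proof -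
  interpret F: bounded_linear F by fact
  have "B \<subseteq> lie"
    using B span_superset unfolding ortho_basis_def by blast
  then have lie: "(\<Sum>E\<in>B. F (x ** E) *\<^sub>R E) \<in> lie"
    by (intro subspace_sum[OF subspace_lie] subspace_scale[OF subspace_lie]) auto
  define v where "v = x ** (\<Sum>E\<in>B. F (x ** E) *\<^sub>R E)"
  have v: "v \<in> tangent_space G x"
    using left_translate_tangent[OF x lie] by (simp add: v_def)
  have gv: "g x v w = dir_deriv G F x w" if w: "w \<in> tangent_space G x" for w
  proof -
    have A: "transpose x ** w \<in> lie"
      using w x tangent_left_iff by blast
    have "g x v w = ip (\<Sum>E\<in>B. F (x ** E) *\<^sub>R E) (transpose x ** w)"
      using metric_left_translate[OF x v w] x by (simp add: v_def)
    also have "\<dots> = (\<Sum>E\<in>B. ip (transpose x ** w) E *\<^sub>R F (x ** E))"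
      by (simp add: ip.sum_left ip.scaleR_left ip_sym[of "transpose x ** w"] mult.commute)
    also have "\<dots> = F (x ** (\<Sum>E\<in>B. ip (transpose x ** w) E *\<^sub>R E))"
      by (simp add: mm.sum_right mm.scaleR_right F.sum F.scaleR)
    also have "\<dots> = F w"
      using x by (simp add: ortho_basis_expand[OF bounded_bilinear_ip B A])
    finally show ?thesis
      by (simp add: dir_deriv_linear[OF F w])
  qed
  have "u = v" if u: "u \<in> tangent_space G x" and gu: "\<And>w. w \<in> tangent_space G x \<Longrightarrow> g x u w = dir_deriv G F x w" for u
  proof -
    have d: "u - v \<in> tangent_space G x"
      using subspace_diff[OF subspace_tangent_space[OF x] u v] .
    have "g x (u - v) (u - v) = g x u (u - v) - g x v (u - v)"
      by (simp add: metric_left_translate[OF x d d] metric_left_translate[OF x u d]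
          metric_left_translate[OF x v d] mm.diff_right ip.diff_left)
    also have "\<dots> = 0"
      using gu[OF d] gv[OF d] by simp
    finally show ?thesis
      using metric_at[OF x d d] by auto
  qed
  then show ?thesis
    unfolding gradient_def v_def[symmetric] using v gv by (intro the_equality conjI ballI) blast+
qed

abbreviation nabla :: "real^'n^'n \<Rightarrow> real^'n^'n \<Rightarrow> (real^'n^'n \<Rightarrow> real^'n^'n) \<Rightarrow> real^'n^'n" where
  "nabla \<equiv> levi_civita G g"

section \<open>Working with the chosen connection through its axioms\<close>

lemma nabla_vector_field:
  "vector_field G X \<Longrightarrow> vector_field G Y \<Longrightarrow> vector_field G (\<lambda>p. nabla p (X p) Y)"
  by (rule is_levi_civita[unfolded is_levi_civita_def, THEN conjunct1, rule_format])

lemma nabla_add: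
  "vector_field G Y \<Longrightarrow> vector_field G Z \<Longrightarrow> p \<in> G \<Longrightarrow> v \<in> tangent_space G p \<Longrightarrow>
    nabla p v (\<lambda>x. Y x + Z x) = nabla p v Y + nabla p v Z"
  by (rule is_levi_civita[unfolded is_levi_civita_def, THEN conjunct2, THEN conjunct2, THEN conjunct1, rule_format])

lemma nabla_scaleR:
  "smooth_map G f \<Longrightarrow> vector_field G Y \<Longrightarrow> p \<in> G \<Longrightarrow> v \<in> tangent_space G p \<Longrightarrow>
    nabla p v (\<lambda>x. f x *\<^sub>R Y x) = dir_deriv G f p v *\<^sub>R Y p + f p *\<^sub>R nabla p v Y"
  by (rule is_levi_civita[unfolded is_levi_civita_def, THEN conjunct2, THEN conjunct2, THEN conjunct2, THEN conjunct1, rule_format])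

lemma nabla_torsion:
  "vector_field G X \<Longrightarrow> vector_field G Y \<Longrightarrow> p \<in> G \<Longrightarrow>
    nabla p (X p) Y - nabla p (Y p) X = lie_bracket G X Y p"
  by (rule is_levi_civita[unfolded is_levi_civita_def, THEN conjunct2, THEN conjunct2, THEN conjunct2, THEN conjunct2, THEN conjunct1, rule_format])

lemma nabla_metric:
  "vector_field G Y \<Longrightarrow> vector_field G Z \<Longrightarrow> p \<in> G \<Longrightarrow> v \<in> tangent_space G p \<Longrightarrow>
    dir_deriv G (\<lambda>x. g x (Y x) (Z x)) p v = g p (nabla p v Y) (Z p) + g p (Y p) (nabla p v Z)"
  by (rule is_levi_civita[unfolded is_levi_civita_def, THEN conjunct2, THEN conjunct2, THEN conjunct2, THEN conjunct2, THEN conjunct2, rule_format])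

lemma vector_field_scaleR:
  "smooth_map G f \<Longrightarrow> vector_field G Y \<Longrightarrow> vector_field G (\<lambda>x. f x *\<^sub>R Y x)"
  by (simp add: vector_field_def smooth_map_bilinear[OF bounded_bilinear_scaleR]
      subspace_scale[OF subspace_tangent_space])

lemma vector_field_vanishing:
  assumes "\<And>x. x \<in> G \<Longrightarrow> Z x = 0"
  shows "vector_field G Z"
  unfolding vector_field_def
proof
  show "smooth_map G Z"
    by (subst smooth_map_cong[of G Z "\<lambda>x. 0", OF assms]) (simp_all add: smooth_map_const)
qed (simp add: assms zero_in_tangent_space)

text \<open>A vector field that vanishes on \<open>G\<close> is unchanged by multiplication with the indicator function
  of the complement of \<open>G\<close>, which is smooth on \<open>G\<close>.\<close>

lemma nabla_vanishing:
  assumes "\<And>x. x \<in> G \<Longrightarrow> Z x = 0" "p \<in> G" "v \<in> tangent_space G p"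
  shows "nabla p v Z = 0"
proof -
  define f :: "real^'n^'n \<Rightarrow> real" where "f = (\<lambda>x. if x \<in> G then 0 else 1)"
  have "smooth_map G f"
    by (subst smooth_map_cong[of G f "\<lambda>x. 0"]) (simp_all add: f_def smooth_map_const)
  from nabla_scaleR[OF this vector_field_vanishing[of Z, OF assms(1)] assms(2,3)]
  have "nabla p v (\<lambda>x. f x *\<^sub>R Z x) = 0"
    using assms by (simp add: f_def)
  moreover have "(\<lambda>x. f x *\<^sub>R Z x) = Z"
    using assms(1) by (auto simp: f_def)
  ultimately show ?thesis by simp
qed

text \<open>The axioms treat fields as functions on the ambient space. Writing \<open>Z\<close> as
  \<open>Y\<close> plus a field vanishing on \<open>G\<close> shows that values off \<open>G\<close>
  have no influence; this matters because \<open>gradient\<close> is unspecified there.\<close>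

lemma nabla_cong:
  assumes "vector_field G Y" "\<And>x. x \<in> G \<Longrightarrow> Y x = Z x" "p \<in> G" "v \<in> tangent_space G p"
  shows "nabla p v Y = nabla p v Z"
proof -
  have "vector_field G (\<lambda>x. Z x - Y x)"
    by (rule vector_field_vanishing) (simp add: assms(2))
  from nabla_add[OF assms(1) this assms(3,4)] nabla_vanishing[of "\<lambda>x. Z x - Y x", OF _ assms(3,4)]
  show ?thesis
    by (simp add: assms(2))
qed

lemma vector_field_sum:
  assumes "\<And>i. i \<in> I \<Longrightarrow> vector_field G (Y i)"
  shows "vector_field G (\<lambda>x. \<Sum>i\<in>I. Y i x)"
  unfolding vector_field_def
proof
  show "smooth_map G (\<lambda>x. \<Sum>i\<in>I. Y i x)"
    using assms by (intro smooth_map_sum) (simp add: vector_field_def)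
  show "\<forall>p\<in>G. (\<Sum>i\<in>I. Y i p) \<in> tangent_space G p"
    using assms by (intro ballI subspace_sum[OF subspace_tangent_space]) (simp_all add: vector_field_def)
qed

lemma nabla_sum:
  assumes "finite I" "\<And>i. i \<in> I \<Longrightarrow> vector_field G (Y i)" "p \<in> G" "v \<in> tangent_space G p"
  shows "nabla p v (\<lambda>x. \<Sum>i\<in>I. Y i x) = (\<Sum>i\<in>I. nabla p v (Y i))"
  using assms(1,2)
proof induction
  case empty
  then show ?case
    by (simp add: nabla_vanishing assms(3,4))
next
  case (insert i I)
  have "nabla p v (\<lambda>x. Y i x + (\<Sum>i\<in>I. Y i x)) = nabla p v (Y i) + nabla p v (\<lambda>x. \<Sum>i\<in>I. Y i x)"
    using insert.prems by (intro nabla_add vector_field_sum assms(3,4)) auto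
  then show ?case
    using insert by simp
qed

lemma vector_field_left_invariant:
  assumes "A \<in> lie"
  shows "vector_field G (\<lambda>y. y ** A)"
  unfolding vector_field_def
proof
  show "smooth_map G (\<lambda>y. y ** A)"
    by (rule smooth_map_linear[OF mm.bounded_linear_left])
qed (simp add: left_translate_tangent assms)

text \<open>Torsion exchanges the two fields at the cost of a bracket. The derivative of
  \<open>A\<close> in direction \<open>E\<close> is orthogonal to \<open>A\<close> because the
  left-invariant field of \<open>A\<close> has constant length, and the bracket is orthogonal to
  \<open>A\<close> by \<open>ip_bracket_self\<close>.\<close>

lemma nabla_left_invariant:
  assumes x: "x \<in> G" and A: "A \<in> lie" and E: "E \<in> lie"
  shows "ip (transpose x ** nabla x (x ** A) (\<lambda>y. y ** E)) A = 0"
proof -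
  note vfA = vector_field_left_invariant[OF A] and vfE = vector_field_left_invariant[OF E]
  note TA = left_translate_tangent[OF x A] and TE = left_translate_tangent[OF x E]
  have N: "nabla x (x ** E) (\<lambda>y. y ** A) \<in> tangent_space G x"
    using nabla_vector_field[OF vfE vfA] x by (simp add: vector_field_def)
  have "0 = dir_deriv G (\<lambda>y. ip A A) x (x ** E)"
    using dir_deriv_const[OF TE] by simp
  also have "\<dots> = dir_deriv G (\<lambda>y. g y (y ** A) (y ** A)) x (x ** E)"
    by (rule dir_deriv_cong[OF x]) (simp add: metric_left_translate left_translate_tangent A)
  also have "\<dots> = 2 * ip (transpose x ** nabla x (x ** E) (\<lambda>y. y ** A)) A"
    using nabla_metric[OF vfA vfA x TE] x ip_sym[of A] by (simp add: metric_left_translate N TA)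
  finally have "ip (transpose x ** nabla x (x ** E) (\<lambda>y. y ** A)) A = 0"
    by simp
  moreover have "nabla x (x ** A) (\<lambda>y. y ** E) = nabla x (x ** E) (\<lambda>y. y ** A) + x ** (A ** E - E ** A)"
    using nabla_torsion[OF vfA vfE x] TA TE
    by (simp add: lie_bracket_def dir_deriv_linear[OF mm.bounded_linear_left] mm.diff_right matrix_mul_assoc algebra_simps)
  moreover have "ip (A ** E - E ** A) A = 0"
    using ip_bracket_self[OF A E] ip.minus_left[of "E ** A - A ** E" A] by simp
  ultimately show ?thesis
    using x by (simp add: mm.add_right ip.add_left)
qed

lemma tangent_space_eq_translate:
  assumes x: "x \<in> G"
  shows "tangent_space G x = (**) x ` lie"
proof
  show "(**) x ` lie \<subseteq> tangent_space G x"
    using left_translate_tangent[OF x] by blast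
  show "tangent_space G x \<subseteq> (**) x ` lie"
  proof
    fix v assume "v \<in> tangent_space G x"
    then have "transpose x ** v \<in> lie"
      using tangent_left_iff[OF x] by simp
    then have "x ** (transpose x ** v) \<in> (**) x ` lie"
      by (rule imageI)
    then show "v \<in> (**) x ` lie"
      using x by simp
  qed
qed

lemma span_translate: "span ((**) y ` S) = (**) y ` span S" for y :: "real^'n^'n"
  by (rule linear_span_image[OF bounded_linear.linear[OF mm.bounded_linear_right]])

lemma ortho_basis_lie_exists: "\<exists>B. ortho_basis ip lie B"
  by (rule ortho_basis_exists[OF bounded_bilinear_ip subspace_lie ip_sym ip_pos])

text \<open>Ensures that the \<open>SOME\<close> in \<open>divergence\<close> selects a genuine
  basis.\<close>

lemma orthonormal_basis_at_exists:
  assumes x: "x \<in> G"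
  shows "\<exists>B. orthonormal_basis_at G g x B"
proof -
  obtain B where B: "ortho_basis ip lie B"
    using ortho_basis_lie_exists ..
  have inj: "x ** E = x ** E' \<longleftrightarrow> E = E'" for E E'
    using cancel_left(1)[OF x] by metis
  have "g x (x ** E) (x ** E') = (if x ** E = x ** E' then 1 else 0)" if "E \<in> B" "E' \<in> B" for E E'
  proof -
    have "E \<in> lie" "E' \<in> lie"
      using that ortho_basis_subset[OF B] by auto
    then have "g x (x ** E) (x ** E') = ip E E'"
      using x by (simp add: metric_left_translate left_translate_tangent)
    then show ?thesis
      using B that by (simp add: inj ortho_basis_def)
  qed
  moreover have "span ((**) x ` B) = tangent_space G x"
    using B unfolding span_translate tangent_space_eq_translate[OF x] ortho_basis_def by blast
  ultimately have "orthonormal_basis_at G g x ((**) x ` B)"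
    unfolding orthonormal_basis_at_def by blast
  then show ?thesis ..
qed

text \<open>Moves the unknown basis chosen by \<open>divergence\<close> to the identity, where it
  can be compared with \<open>B\<close>. Finiteness, which \<open>orthonormal_basis_at\<close> does
  not state, comes from independence.\<close>

lemma ortho_basis_left_trivialisation:
  assumes x: "x \<in> G" and C: "orthonormal_basis_at G g x C"
  shows "ortho_basis ip lie ((**) (transpose x) ` C)"
proof -
  have C_T: "C \<subseteq> tangent_space G x"
    using C span_superset unfolding orthonormal_basis_at_def by blast
  have inj: "transpose x ** u = transpose x ** v \<longleftrightarrow> u = v" for u v
    using cancel_left(2)[OF x] by metis
  have "ip (transpose x ** u) (transpose x ** v) = (if transpose x ** u = transpose x ** v then 1 else 0)"
    if "u \<in> C" "v \<in> C" for u v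
  proof -
    have "ip (transpose x ** u) (transpose x ** v) = g x u v"
      using that C_T by (intro metric_left_translate[OF x, symmetric]) auto
    then show ?thesis
      using C that by (simp add: inj orthonormal_basis_at_def)
  qed
  then have on: "\<forall>u\<in>(**) (transpose x) ` C. \<forall>v\<in>(**) (transpose x) ` C. ip u v = (if u = v then 1 else 0)"
    by blast
  have "span C = (**) x ` lie"
    using C unfolding orthonormal_basis_at_def tangent_space_eq_translate[OF x] by blast
  then have "span ((**) (transpose x) ` C) = lie"
    using x by (simp add: span_translate image_image)
  moreover have "independent ((**) (transpose x) ` C)"
    by (rule orthonormal_independent[OF bounded_bilinear_ip]) (use on in blast)
  ultimately show ?thesis
    using on independent_imp_finite unfolding ortho_basis_def by blast
qed

text \<open>The diagonal of the Hessian, which is all that the trace requires. In the product rule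
  for the sum of the fields \<open>F (y ** E) *\<^sub>R (y ** E)\<close>, the derivatives of
  left-invariant fields drop out by \<open>nabla_left_invariant\<close>.\<close>

lemma metric_nabla_gradient_linear:
  assumes B: "ortho_basis ip lie B" and F: "bounded_linear F" and x: "x \<in> G" and A: "A \<in> lie"
  shows "g x (nabla x (x ** A) (gradient G g F)) (x ** A) = F (x ** A ** A)"
proof -
  interpret F: bounded_linear F by fact
  have B_lie: "E \<in> lie" if "E \<in> B" for E
    using ortho_basis_subset[OF B] that by blast
  have finB: "finite B"
    using B by (simp add: ortho_basis_def)
  have TA: "x ** A \<in> tangent_space G x"
    by (rule left_translate_tangent[OF x A])
  have FE: "bounded_linear (\<lambda>y. F (y ** E))" for E
    by (rule bounded_linear_compose[OF F mm.bounded_linear_left])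
  define V where "V E y = F (y ** E) *\<^sub>R (y ** E)" for E y :: "real^'n^'n"
  have V: "vector_field G (V E)" if "E \<in> B" for E
    unfolding V_def
    by (rule vector_field_scaleR[OF smooth_map_linear[OF FE] vector_field_left_invariant[OF B_lie[OF that]]])
  have VS: "vector_field G (\<lambda>y. \<Sum>E\<in>B. V E y)"
    by (rule vector_field_sum[OF V])
  have grad: "(\<Sum>E\<in>B. V E y) = gradient G g F y" if "y \<in> G" for y
    by (simp add: V_def gradient_linear[OF B F that] mm.sum_right mm.scaleR_right)
  have nablaV: "nabla x (x ** A) (V E) = F (x ** A ** E) *\<^sub>R (x ** E) + F (x ** E) *\<^sub>R nabla x (x ** A) (\<lambda>y. y ** E)"
    if "E \<in> B" for E
    using nabla_scaleR[OF smooth_map_linear[OF FE[of E]] vector_field_left_invariant[OF B_lie[OF that]] x TA]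
    unfolding V_def by (simp add: dir_deriv_linear[OF FE TA])
  have "nabla x (x ** A) (gradient G g F) = nabla x (x ** A) (\<lambda>y. \<Sum>E\<in>B. V E y)"
    by (rule nabla_cong[OF VS grad x TA, symmetric])
  also have "\<dots> = (\<Sum>E\<in>B. nabla x (x ** A) (V E))"
    by (rule nabla_sum[OF finB V x TA])
  also have "\<dots> = (\<Sum>E\<in>B. F (x ** A ** E) *\<^sub>R (x ** E) + F (x ** E) *\<^sub>R nabla x (x ** A) (\<lambda>y. y ** E))"
    by (rule sum.cong[OF refl nablaV])
  finally have eq: "nabla x (x ** A) (gradient G g F) =
      (\<Sum>E\<in>B. F (x ** A ** E) *\<^sub>R (x ** E) + F (x ** E) *\<^sub>R nabla x (x ** A) (\<lambda>y. y ** E))" .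
  have "vector_field G (gradient G g F)"
    using VS grad smooth_map_cong[of G "\<lambda>y. \<Sum>E\<in>B. V E y" "gradient G g F"]
    unfolding vector_field_def by simp
  from nabla_vector_field[OF vector_field_left_invariant[OF A] this] x
  have "nabla x (x ** A) (gradient G g F) \<in> tangent_space G x"
    by (simp add: vector_field_def)
  from metric_left_translate[OF x this TA] x
  have "g x (nabla x (x ** A) (gradient G g F)) (x ** A) =
      ip (transpose x ** nabla x (x ** A) (gradient G g F)) A"
    by simp
  also have "\<dots> = (\<Sum>E\<in>B. F (x ** A ** E) * ip E A + F (x ** E) * ip (transpose x ** nabla x (x ** A) (\<lambda>y. y ** E)) A)"
    unfolding eq using x
    by (simp add: mm.sum_right mm.add_right mm.scaleR_right ip.sum_left ip.add_left ip.scaleR_left)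
  also have "\<dots> = (\<Sum>E\<in>B. F (x ** A ** E) * ip A E)"
    by (rule sum.cong[OF refl]) (simp add: nabla_left_invariant[OF x A B_lie] ip_sym[of A])
  also have "\<dots> = F (x ** A ** (\<Sum>E\<in>B. ip A E *\<^sub>R E))"
    by (simp add: mm.sum_right mm.scaleR_right F.sum F.scaleR mult.commute)
  finally show ?thesis
    by (simp add: ortho_basis_expand[OF bounded_bilinear_ip B A])
qed

text \<open>The chosen basis, translated to the identity, is exchanged for \<open>B\<close> by
  \<open>ortho_basis_trace\<close> applied to the bilinear form
  \<open>F (x ** A ** C)\<close>.\<close>

lemma divergence_gradient_linear:
  assumes B: "ortho_basis ip lie B" and F: "bounded_linear F" and x: "x \<in> G"
  shows "divergence G g (gradient G g F) x = (\<Sum>E\<in>B. F (x ** E ** E))"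
proof -
  define C where "C = (SOME B. orthonormal_basis_at G g x B)"
  have "orthonormal_basis_at G g x C"
    unfolding C_def by (rule someI_ex[OF orthonormal_basis_at_exists[OF x]])
  from ortho_basis_left_trivialisation[OF x this]
  have C: "ortho_basis ip lie ((**) (transpose x) ` C)" .
  have inj: "inj_on ((**) (transpose x)) C"
    using cancel_left(2)[OF x] by (metis inj_onI)
  have bil: "bounded_bilinear (\<lambda>A C. F (x ** A ** C))"
    unfolding bilinear_conv_bounded_bilinear[symmetric] bilinear_def
    by (auto intro!: linearI simp: linear_simps[OF F] mm.add_left mm.add_right mm.scaleR_left mm.scaleR_right)
  have "divergence G g (gradient G g F) x = (\<Sum>e\<in>C. g x (nabla x e (gradient G g F)) e)"
    by (simp add: divergence_def C_def)
  also have "\<dots> = (\<Sum>A\<in>(**) (transpose x) ` C. g x (nabla x (x ** A) (gradient G g F)) (x ** A))"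
    unfolding sum.reindex[OF inj] using x by simp
  also have "\<dots> = (\<Sum>A\<in>(**) (transpose x) ` C. F (x ** A ** A))"
    using ortho_basis_subset[OF C] by (intro sum.cong[OF refl] metric_nabla_gradient_linear[OF B F x]) blast
  also have "\<dots> = (\<Sum>A\<in>B. F (x ** A ** A))"
    by (rule ortho_basis_trace[OF bounded_bilinear_ip ip_sym B C bil])
  finally show ?thesis .
qed

lemma laplacian_linear:
  assumes B: "ortho_basis ip lie B" and \<phi>: "bounded_linear \<phi>" and x: "x \<in> G"
  shows "laplacian G g \<phi> x = (\<Sum>E\<in>B. \<phi> (x ** E ** E))"
proof -
  have re: "bounded_linear (\<lambda>y. Re (\<phi> y))" and im: "bounded_linear (\<lambda>y. Im (\<phi> y))"
    using bounded_linear_compose[OF bounded_linear_Re \<phi>] bounded_linear_compose[OF bounded_linear_Im \<phi>]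
    by simp_all
  have "laplacian G g \<phi> x = Complex (\<Sum>E\<in>B. Re (\<phi> (x ** E ** E))) (\<Sum>E\<in>B. Im (\<phi> (x ** E ** E)))"
    unfolding laplacian_def cdivergence_def cgradient_def fst_conv snd_conv
    by (simp only: divergence_gradient_linear[OF B re x] divergence_gradient_linear[OF B im x])
  then show ?thesis
    by (simp add: complex_eq_iff)
qed

text \<open>Parseval's identity for the real gradients; the four real products recombine to the
  complex one because \<open>cmetric\<close> is complex bilinear.\<close>

lemma conformality_linear:
  assumes B: "ortho_basis ip lie B" and \<phi>: "bounded_linear \<phi>" and \<psi>: "bounded_linear \<psi>" and x: "x \<in> G"
  shows "conformality G g \<phi> \<psi> x = (\<Sum>E\<in>B. \<phi> (x ** E) * \<psi> (x ** E))"
proof -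
  have B_lie: "B \<subseteq> lie"
    by (rule ortho_basis_subset[OF B])
  have *: "g x (gradient G g F x) (gradient G g H x) = (\<Sum>E\<in>B. F (x ** E) * H (x ** E))"
    if F: "bounded_linear F" and H: "bounded_linear H" for F H
  proof -
    have T: "x ** (\<Sum>E\<in>B. F (x ** E) *\<^sub>R E) \<in> tangent_space G x" for F :: "real^'n^'n \<Rightarrow> real"
      using B_lie by (intro left_translate_tangent[OF x] subspace_sum[OF subspace_lie] subspace_scale[OF subspace_lie]) auto
    have "g x (gradient G g F x) (gradient G g H x) =
        ip (\<Sum>E\<in>B. F (x ** E) *\<^sub>R E) (\<Sum>E\<in>B. H (x ** E) *\<^sub>R E)"
      using x by (simp add: gradient_linear[OF B F x] gradient_linear[OF B H x] metric_left_translate[OF x T T])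
    also have "\<dots> = (\<Sum>E\<in>B. H (x ** E) * ip (\<Sum>E\<in>B. F (x ** E) *\<^sub>R E) E)"
      by (simp add: ip.sum_right ip.scaleR_right)
    also have "\<dots> = (\<Sum>E\<in>B. F (x ** E) * H (x ** E))"
      using B unfolding ortho_basis_def
      by (intro sum.cong) (auto simp: orthonormal_sum[OF bounded_bilinear_ip])
    finally show ?thesis .
  qed
  have re: "bounded_linear (\<lambda>y. Re (f y))" and im: "bounded_linear (\<lambda>y. Im (f y))"
    if "bounded_linear f" for f :: "real^'n^'n \<Rightarrow> complex"
    using bounded_linear_compose[OF bounded_linear_Re that] bounded_linear_compose[OF bounded_linear_Im that]
    by simp_all
  have "conformality G g \<phi> \<psi> x = Complex
      ((\<Sum>E\<in>B. Re (\<phi> (x ** E)) * Re (\<psi> (x ** E))) - (\<Sum>E\<in>B. Im (\<phi> (x ** E)) * Im (\<psi> (x ** E))))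
      ((\<Sum>E\<in>B. Re (\<phi> (x ** E)) * Im (\<psi> (x ** E))) + (\<Sum>E\<in>B. Im (\<phi> (x ** E)) * Re (\<psi> (x ** E))))"
    unfolding conformality_def cmetric_def cgradient_def fst_conv snd_conv
    by (simp only: *[OF re[OF \<phi>] re[OF \<psi>]] *[OF im[OF \<phi>] im[OF \<psi>]]
        *[OF re[OF \<phi>] im[OF \<psi>]] *[OF im[OF \<phi>] re[OF \<psi>]])
  then show ?thesis
    by (simp add: complex_eq_iff sum_subtractf sum.distrib)
qed

end

section \<open>Seven-dimensional cross products\<close>

text \<open>An orthogonal matrix taking \<open>axis k 1\<close> to \<open>v\<close> conjugates the
  reflection to a diagonal matrix with a single entry -1.\<close>

lemma det_reflection:
  fixes v :: "real^'n"
  assumes "norm v = 1"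
  shows "det (matrix (\<lambda>x. x - (2 * (v \<bullet> x)) *\<^sub>R v)) = - 1"
proof -
  define k :: 'n where "k = undefined"
  obtain A where A: "orthogonal_matrix A" "A *v (axis k 1) = v"
    using orthogonal_matrix_exists_basis[OF assms] by blast
  define D :: "real^'n^'n" where "D = (\<chi> i j. if i = j then if i = k then - 1 else 1 else 0)"
  have D: "D *v x = x - (2 * (axis k 1 \<bullet> x)) *\<^sub>R axis k 1" for x
    unfolding inner_axis' by (auto simp: D_def vec_eq_iff matrix_vector_mult_def mult_delta_left axis_def)
  have e: "axis k 1 \<bullet> (transpose A *v x) = v \<bullet> x" for x
    using dot_lmul_matrix[of x A "axis k 1"] A(2) by (simp add: inner_commute)
  have "A ** transpose A = mat 1"
    using A(1) by (simp add: orthogonal_matrix_def)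
  then have inv: "A *v (transpose A *v x) = x" for x
    unfolding matrix_vector_mul_assoc by simp
  have "(A ** D ** transpose A) *v x = x - (2 * (v \<bullet> x)) *\<^sub>R v" for x
    unfolding matrix_vector_mul_assoc[symmetric] D e matrix_vector_mult_diff_distrib
      matrix_vector_mult_scaleR inv A(2) ..
  then have "(\<lambda>x. x - (2 * (v \<bullet> x)) *\<^sub>R v) = (*v) (A ** D ** transpose A)"
    by (intro ext) simp
  then have "matrix (\<lambda>x. x - (2 * (v \<bullet> x)) *\<^sub>R v) = A ** D ** transpose A"
    by (simp only: matrix_of_matrix_vector_mul)
  moreover have "det A * det A = 1"
    using det_orthogonal_matrix[OF A(1)] by auto
  moreover have "det D = - 1"
    by (subst det_diagonal) (simp_all add: D_def)
  ultimately show ?thesis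
    by (simp add: det_mul)
qed

locale cross7 =
  fixes X :: "real^7 \<Rightarrow> real^7 \<Rightarrow> real^7"
  assumes cross: "cross_product7 X"
begin

sublocale X: bounded_bilinear X
  using cross by (simp add: cross_product7_def bilinear_conv_bounded_bilinear)

lemma skew: "X u v = - X v u"
  using cross unfolding cross_product7_def by blast

lemma inner_left [simp]: "X u v \<bullet> u = 0"
  using cross unfolding cross_product7_def by blast

lemma self [simp]: "X u u = 0"
  using skew[of u u] by (simp add: eq_neg_iff_add_eq_0 flip: scaleR_2)

lemma inner_right [simp]: "X u v \<bullet> v = 0"
  using inner_left[of v u] skew[of u v] by simp

text \<open>Polarisation of \<open>inner_left\<close>; together with \<open>skew\<close> it makes
  the trilinear form alternating.\<close>

lemma triple_swap: "X u v \<bullet> w = - (X w v \<bullet> u)"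
  using inner_left[of "u + w" v] by (simp add: X.add_left inner_add_left inner_add_right)

lemma triple_cycle: "X u v \<bullet> w = X v w \<bullet> u"
  using triple_swap[of u v w] skew[of w v] by simp

lemma norm_cross: "X u v \<bullet> X u v = (u \<bullet> u) * (v \<bullet> v) - (u \<bullet> v)\<^sup>2"
  using cross unfolding cross_product7_def power2_norm_eq_inner by blast

lemma inner_cross_cross: "X u v \<bullet> X u w = (u \<bullet> u) * (v \<bullet> w) - (u \<bullet> v) * (u \<bullet> w)"
  using norm_cross[of u "v + w"] norm_cross[of u v] norm_cross[of u w]
  by (simp add: X.add_right inner_add_left inner_add_right inner_commute power2_eq_square algebra_simps)

lemma double: "X u (X u v) = (u \<bullet> v) *\<^sub>R u - (u \<bullet> u) *\<^sub>R v"
proof (rule vector_eq_rdot[THEN iffD1, rule_format])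
  fix w
  have "X u (X u v) \<bullet> w = X w u \<bullet> X u v"
    using triple_cycle[of u "X u v" w] triple_cycle[of "X u v" w u] by simp
  also have "\<dots> = - (X u w \<bullet> X u v)"
    using skew[of w u] by simp
  also have "\<dots> = ((u \<bullet> v) *\<^sub>R u - (u \<bullet> u) *\<^sub>R v) \<bullet> w"
    using inner_cross_cross[of u w v] by (simp add: inner_diff_left inner_commute[of w v])
  finally show "X u (X u v) \<bullet> w = ((u \<bullet> v) *\<^sub>R u - (u \<bullet> u) *\<^sub>R v) \<bullet> w" .
qed

text \<open>If \<open>u\<close>, \<open>w\<close>, \<open>v\<close> are pairwise orthogonal, the
  right-hand side vanishes: \<open>X u\<close> and \<open>X w\<close> anticommute on
  \<open>v\<close>.\<close>

lemma double_polarised: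
  "X u (X w v) + X w (X u v) = (u \<bullet> v) *\<^sub>R w + (w \<bullet> v) *\<^sub>R u - (2 * (u \<bullet> w)) *\<^sub>R v"
  using double[of "u + w" v] double[of u v] double[of w v]
  by (simp add: X.add_left X.add_right inner_add_left inner_add_right inner_commute algebra_simps)

text \<open>\<open>a\<close>, \<open>u\<close>, \<open>c\<close> multiply like the imaginary units of the quaternions.\<close>

definition triple :: "real^7 \<Rightarrow> real^7 \<Rightarrow> real^7 \<Rightarrow> bool" where
  "triple a u c \<longleftrightarrow> a \<bullet> a = 1 \<and> u \<bullet> u = 1 \<and> c \<bullet> c = 1 \<and> a \<bullet> u = 0 \<and> u \<bullet> c = 0 \<and> c \<bullet> a = 0 \<and>
     X a u = c \<and> X u c = a \<and> X c a = u"

lemma tripleI: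
  assumes "a \<bullet> a = 1" "u \<bullet> u = 1" "a \<bullet> u = 0"
  shows "triple a u (X a u)"
proof -
  have "X (X a u) a = u"
    using skew[of "X a u" a] double[of a u] assms by simp
  moreover have "X u (X a u) = a"
    using skew[of a u] double[of u a] assms by (simp add: X.minus_right inner_commute)
  ultimately show ?thesis
    using assms norm_cross[of a u] by (simp add: triple_def inner_commute[of u "X a u"])
qed

lemma triple_rotate: "triple a u c \<Longrightarrow> triple u c a"
  by (auto simp: triple_def)

definition perp :: "real^7 \<Rightarrow> real^7 \<Rightarrow> real^7 \<Rightarrow> real^7 \<Rightarrow> bool" where
  "perp a u c x \<longleftrightarrow> a \<bullet> x = 0 \<and> u \<bullet> x = 0 \<and> c \<bullet> x = 0"

text \<open>By \<open>triple_cycle\<close> the components of \<open>X a x\<close> along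
  \<open>u\<close> and \<open>c\<close> are, up to sign, those of \<open>x\<close> along
  \<open>c\<close> and \<open>u\<close>. The complement is thus stable under quaternionic
  multiplication.\<close>

lemma perp_cross:
  assumes "triple a u c" "perp a u c x"
  shows "perp a u c (X a x)"
proof -
  have "X a x \<bullet> u = X u a \<bullet> x"
    using triple_cycle[of u a x] by simp
  also have "\<dots> = 0"
    using assms skew[of u a] by (simp add: triple_def perp_def)
  finally have "X a x \<bullet> u = 0" .
  moreover have "X a x \<bullet> c = 0"
    using triple_cycle[of c a x] assms by (simp add: triple_def perp_def)
  ultimately show ?thesis
    by (simp add: perp_def inner_commute[of _ "X a x"])
qed

text \<open>Pairing \<open>double_polarised\<close> with \<open>t\<close> kills its right-hand side,
  because \<open>a\<close> is orthogonal to \<open>x\<close>, \<open>y\<close> and \<open>t\<close>;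
  then \<open>X a\<close> is moved across the inner product by skewness.\<close>

lemma triple_move:
  assumes "perp a u c x" "perp a u c y" "perp a u c t"
  shows "X x (X a y) \<bullet> t = X x y \<bullet> X a t"
proof -
  have "(X a (X x y) + X x (X a y)) \<bullet> t = 0"
    using assms by (simp add: double_polarised perp_def inner_add_left inner_diff_left inner_commute)
  moreover have "X a (X x y) \<bullet> t = - (X a t \<bullet> X x y)"
    using triple_cycle[of t a "X x y"] skew[of t a] by simp
  ultimately show ?thesis
    by (simp add: inner_add_left inner_commute[of "X x y"])
qed

text \<open>Multiplication by \<open>a\<close>, \<open>u\<close> or \<open>c\<close> can be moved between the arguments of the trilinear form.
  Since \<open>a\<close> and \<open>u\<close> anticommute, moving \<open>c = a u\<close> directly or factor by factor gives opposite signs.\<close>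

lemma triple_vanishes:
  assumes T: "triple a u c" and x: "perp a u c x" and y: "perp a u c y" and t: "perp a u c t"
  shows "X x y \<bullet> t = 0"
proof -
  note Tu = triple_rotate[OF T] and Tc = triple_rotate[OF triple_rotate[OF T]]
  have pa: "perp a u c (X a z)" and pu: "perp a u c (X u z)" and pc: "perp a u c (X c z)" if "perp a u c z" for z
    using that perp_cross[OF T] perp_cross[OF Tu] perp_cross[OF Tc] by (auto simp: perp_def)
  have ma: "X x (X a z) \<bullet> w = X x z \<bullet> X a w" and mu: "X x (X u z) \<bullet> w = X x z \<bullet> X u w"
    and mc: "X x (X c z) \<bullet> w = X x z \<bullet> X c w" if "perp a u c z" "perp a u c w" for z w
    using triple_move[of a u c x z w] triple_move[of u c a x z w] triple_move[of c a u x z w] x that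
    by (auto simp: perp_def)
  have au: "X a (X u z) = - X c z" and ua: "X u (X a z) = X c z" if "perp a u c z" for z
  proof -
    have "X a (X z u) + X z (X a u) = 0"
      using double_polarised[of a z u] that T by (simp add: perp_def triple_def inner_commute)
    then show "X a (X u z) = - X c z"
      using skew[of z u] skew[of z c] T by (simp add: X.minus_right triple_def)
    moreover have "X a (X u z) + X u (X a z) = 0"
      using double_polarised[of a u z] that T by (simp add: perp_def triple_def)
    ultimately show "X u (X a z) = X c z"
      by simp
  qed
  have "X x y \<bullet> X c w = 0" if w: "perp a u c w" for w
  proof -
    have "X x y \<bullet> X c w = X x (X c y) \<bullet> w"
      using mc[OF y w] by simp
    also have "\<dots> = X x (X u (X a y)) \<bullet> w"
      by (simp add: ua[OF y])
    also have "\<dots> = X x y \<bullet> X a (X u w)"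
      by (simp add: mu[OF pa[OF y] w] ma[OF y pu[OF w]])
    also have "\<dots> = - (X x y \<bullet> X c w)"
      by (simp add: au[OF w])
    finally show ?thesis by simp
  qed
  \<comment> \<open>Every \<open>t\<close> in the complement has the form \<open>X c w\<close>: take
    \<open>w = - X c t\<close>, as \<open>c\<close> is a unit vector orthogonal to
    \<open>t\<close>.\<close>
  from this[OF pc[OF t]] show ?thesis
    using double[of c t] t T by (simp add: perp_def triple_def)
qed

text \<open>The automorphism that is \<open>1\<close> on the quaternionic subalgebra \<open>\<langle>a, u, c\<rangle>\<close> and \<open>-1\<close> on its
  orthogonal complement.\<close>

definition flip3 :: "real^7 \<Rightarrow> real^7 \<Rightarrow> real^7 \<Rightarrow> real^7 \<Rightarrow> real^7" where
  "flip3 a u c v = 2 *\<^sub>R ((a \<bullet> v) *\<^sub>R a + (u \<bullet> v) *\<^sub>R u + (c \<bullet> v) *\<^sub>R c) - v"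

lemma linear_flip3: "linear (flip3 a u c)"
  by (rule linearI) (simp_all add: flip3_def inner_add_right algebra_simps)

lemma flip3_fix:
  assumes "triple a u c"
  shows "flip3 a u c a = a" "flip3 a u c u = u" "flip3 a u c c = c"
  using assms by (simp_all add: flip3_def triple_def inner_commute scaleR_2)

lemma flip3_perp: "perp a u c x \<Longrightarrow> flip3 a u c x = - x"
  by (simp add: flip3_def perp_def)

lemma flip3_inner:
  assumes "triple a u c"
  shows "flip3 a u c v \<bullet> flip3 a u c w = v \<bullet> w"
  using assms
  by (simp add: flip3_def triple_def inner_add_left inner_add_right inner_diff_left inner_diff_right inner_commute algebra_simps)

text \<open>The span of the triple and its complement form a grading modulo 2: even times even is
  even, even times odd is odd (\<open>perp_cross\<close>), odd times odd is even
  (\<open>triple_vanishes\<close>). The sign map of a grading is multiplicative.\<close>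

lemma flip3_cross:
  assumes T: "triple a u c"
  shows "flip3 a u c (X v w) = X (flip3 a u c v) (flip3 a u c w)"
proof -
  interpret k: linear "flip3 a u c"
    by (rule linear_flip3)
  note Tu = triple_rotate[OF T] and Tc = triple_rotate[OF triple_rotate[OF T]]
  define h where "h = (\<lambda>v. (a \<bullet> v) *\<^sub>R a + (u \<bullet> v) *\<^sub>R u + (c \<bullet> v) *\<^sub>R c)"
  have perp_rest: "perp a u c (v - h v)" for v
    using T by (simp add: h_def perp_def triple_def inner_add_right inner_diff_right inner_commute)
  have fix_h: "flip3 a u c (h v) = h v" for v
    by (simp add: h_def k.add k.scale flip3_fix[OF T])
  have p: "perp a u c (X (h v) x)" if "perp a u c x" for v x
    using perp_cross[OF T that] perp_cross[OF Tu] perp_cross[OF Tc] that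
    by (simp add: h_def perp_def X.add_left X.scaleR_left inner_add_right)
  have m1: "flip3 a u c (X (h v) (h w)) = X (h v) (h w)" for v w
    using T skew[of u a] skew[of c u] skew[of a c]
    by (simp add: h_def X.add_left X.add_right X.scaleR_left X.scaleR_right k.add k.diff k.scale k.neg triple_def flip3_fix[OF T])
  have m2: "flip3 a u c (X x y) = X x y" if "perp a u c x" "perp a u c y" for x y
  proof -
    define z where "z = X x y - h (X x y)"
    have "perp a u c z"
      by (simp add: z_def perp_rest)
    then have "X x y \<bullet> z = 0" "h (X x y) \<bullet> z = 0"
      using triple_vanishes[OF T that] by (simp_all add: h_def perp_def inner_add_left)
    then have "z \<bullet> z = 0"
      by (simp add: z_def inner_diff_left)
    then have "X x y = h (X x y)"
      by (simp add: z_def)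
    then show ?thesis
      using fix_h by metis
  qed
  define v' w' where "v' = v - h v" and "w' = w - h w"
  have v': "perp a u c v'" "perp a u c w'"
    by (simp_all add: v'_def w'_def perp_rest)
  have vw: "v = h v + v'" "w = h w + w'"
    by (simp_all add: v'_def w'_def)
  have kv: "flip3 a u c v = h v - v'" "flip3 a u c w = h w - w'"
    using k.add[of "h v" v'] k.add[of "h w" w'] by (simp_all add: fix_h flip3_perp v' flip: vw)
  have "X (h v + v') (h w + w') = X (h v) (h w) + X (h v) w' + X v' (h w) + X v' w'"
    by (simp add: X.add_left X.add_right)
  then have "X v w = X (h v) (h w) + X (h v) w' + X v' (h w) + X v' w'"
    by (simp flip: vw)
  moreover have "flip3 a u c (X (h v) w') = - X (h v) w'" "flip3 a u c (X v' (h w)) = - X v' (h w)"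
    using p[OF v'(2), of v] p[OF v'(1), of w] skew[of v' "h w"] by (simp_all add: flip3_perp k.neg)
  ultimately show ?thesis
    by (simp add: kv k.add m1 m2[OF v'] X.diff_left X.diff_right)
qed

text \<open>Reflecting in \<open>a\<close>, \<open>u\<close>, \<open>c\<close> and then negating
  gives \<open>flip3\<close>: three signs from the reflections and seven from the negation.\<close>

lemma det_flip3:
  assumes "triple a u c"
  shows "det (matrix (flip3 a u c)) = 1"
proof -
  define r where "r = (\<lambda>v x::real^7. x - (2 * (v \<bullet> x)) *\<^sub>R v)"
  have lin: "linear (r v)" for v
    by (rule linearI) (simp_all add: r_def inner_add_right algebra_simps)
  have n: "norm a = 1" "norm u = 1" "norm c = 1"
    using assms by (simp_all add: triple_def norm_eq_1)
  have eq: "flip3 a u c = (*\<^sub>R) (- 1) \<circ> (r a \<circ> (r u \<circ> r c))"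
    using assms
    by (auto simp: fun_eq_iff flip3_def r_def triple_def inner_diff_right inner_commute algebra_simps)
  have "matrix (flip3 a u c) = matrix ((*\<^sub>R) (- 1)) ** (matrix (r a) ** (matrix (r u) ** matrix (r c)))"
    unfolding eq by (simp add: matrix_compose lin linear_compose)
  moreover have "det (matrix (r v)) = - 1" if "norm v = 1" for v
    using det_reflection[OF that] by (simp add: r_def)
  ultimately show ?thesis
    using n by (simp add: det_mul del: scaleR_minus1_left)
qed

lemma flip3_in_G2:
  assumes "triple a u c"
  shows "matrix (flip3 a u c) \<in> G2 X"
proof -
  have "orthogonal_transformation (flip3 a u c)"
    unfolding orthogonal_transformation_def using linear_flip3 flip3_inner[OF assms] by blast
  then have "orthogonal_matrix (matrix (flip3 a u c))"
    by (simp add: orthogonal_transformation_matrix)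
  then show ?thesis
    by (simp add: G2_def det_flip3[OF assms] matrix_works linear_flip3 flip3_cross[OF assms])
qed

end

section \<open>The group structure of G2\<close>

lemma G2_group:
  shows "mat 1 \<in> G2 X" "A \<in> G2 X \<Longrightarrow> B \<in> G2 X \<Longrightarrow> A ** B \<in> G2 X" "A \<in> G2 X \<Longrightarrow> transpose A \<in> G2 X"
    "A \<in> G2 X \<Longrightarrow> orthogonal_matrix A"
proof -
  show "mat 1 \<in> G2 X"
    by (simp add: G2_def orthogonal_matrix_def)
  show "A ** B \<in> G2 X" if "A \<in> G2 X" "B \<in> G2 X"
    using that by (simp add: G2_def orthogonal_matrix_mul det_mul flip: matrix_vector_mul_assoc)
  show "A \<in> G2 X \<Longrightarrow> orthogonal_matrix A"
    by (simp add: G2_def)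
  show "transpose A \<in> G2 X" if A: "A \<in> G2 X"
  proof -
    have inv: "transpose A *v (A *v x) = x" "A *v (transpose A *v x) = x" for x
      using A by (simp_all add: G2_def orthogonal_matrix_def matrix_vector_mul_assoc del: transpose_matrix_vector)
    have "transpose A *v X v w = X (transpose A *v v) (transpose A *v w)" for v w
    proof -
      have "A *v X (transpose A *v v) (transpose A *v w) = X v w"
        using A inv by (simp add: G2_def del: transpose_matrix_vector)
      then show ?thesis
        by (metis inv(1))
    qed
    then show ?thesis
      using A by (simp add: G2_def del: transpose_matrix_vector)
  qed
qed

section \<open>Invariance of sums over a basis of the Lie algebra\<close>

context bi_invariant_group
begin

lemma ortho_basis_conjugate:
  assumes h: "h \<in> G" and B: "ortho_basis ip lie B"
  shows "ortho_basis ip lie ((\<lambda>E. h ** E ** transpose h) ` B)"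
proof -
  define f where "f = (\<lambda>E. h ** E ** transpose h)"
  have lin: "linear f"
    unfolding f_def by (rule linearI) (simp_all add: mm.add_left mm.add_right mm.scaleR_left mm.scaleR_right)
  have f_inv: "f (transpose h ** E ** h) = E" "transpose h ** f E ** h = E" for E
    using h by (simp_all add: f_def flip: matrix_mul_assoc)
  have "f ` lie = lie"
  proof
    show "f ` lie \<subseteq> lie"
      using lie_conjugate[OF h] by (auto simp: f_def)
    show "lie \<subseteq> f ` lie"
    proof
      fix A assume "A \<in> lie"
      then have "transpose h ** A ** h \<in> lie"
        using lie_conjugate[OF inv[OF h]] by simp
      then show "A \<in> f ` lie"
        using f_inv(1)[of A] by (metis imageI)
    qed
  qed
  then have "span (f ` B) = lie"
    using linear_span_image[OF lin, of B] B by (simp add: ortho_basis_def)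
  moreover have "ip (f E) (f E') = (if f E = f E' then 1 else 0)" if "E \<in> B" "E' \<in> B" for E E'
  proof -
    have "f E = f E' \<longleftrightarrow> E = E'"
      using f_inv(2) by metis
    moreover have "ip (f E) (f E') = ip E E'"
      using that ortho_basis_subset[OF B] unfolding f_def by (intro ip_conjugate[OF h]) auto
    ultimately show ?thesis
      using B that by (simp add: ortho_basis_def)
  qed
  ultimately show ?thesis
    using B unfolding f_def[symmetric] ortho_basis_def by auto
qed

text \<open>Conjugation is an isometry of \<open>ip\<close>, so it maps \<open>B\<close> to another
  orthonormal basis, over which the trace of \<open>W\<close> is the same.\<close>

lemma sum_conjugate:
  fixes W :: "real^'n^'n \<Rightarrow> real^'n^'n \<Rightarrow> 'b::real_normed_vector"
  assumes h: "h \<in> G" and B: "ortho_basis ip lie B" and W: "bounded_bilinear W"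
  shows "(\<Sum>E\<in>B. W (h ** E ** transpose h) (h ** E ** transpose h)) = (\<Sum>E\<in>B. W E E)"
proof -
  have "inj_on (\<lambda>E. h ** E ** transpose h) B"
  proof (rule inj_onI)
    fix E E' assume "h ** E ** transpose h = h ** E' ** transpose h"
    then have "transpose h ** (h ** E ** transpose h) ** h = transpose h ** (h ** E' ** transpose h) ** h"
      by simp
    then show "E = E'"
      using h by (simp flip: matrix_mul_assoc)
  qed
  then have "(\<Sum>E\<in>B. W (h ** E ** transpose h) (h ** E ** transpose h)) =
      (\<Sum>E\<in>(\<lambda>E. h ** E ** transpose h) ` B. W E E)"
    by (simp add: sum.reindex)
  also have "\<dots> = (\<Sum>E\<in>B. W E E)"
    by (rule ortho_basis_trace[OF bounded_bilinear_ip ip_sym B ortho_basis_conjugate[OF h B] W])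
  finally show ?thesis .
qed

lemma lie_inner_skew:
  assumes "E \<in> lie"
  shows "(E *v x) \<bullet> y = - ((E *v y) \<bullet> x)"
proof -
  have "(E *v x) \<bullet> y = x \<bullet> (transpose E *v y)"
    using dot_lmul_matrix[of y E x] by (simp add: inner_commute)
  also have "\<dots> = - ((E *v y) \<bullet> x)"
    unfolding lie_skew[OF assms] using matrix_vector_mult_diff_rdistrib[of 0 E y] by (simp add: inner_commute)
  finally show ?thesis .
qed

end

section \<open>The invariant quartic form\<close>

text \<open>A list with a bound on its length accommodates coinciding or dependent vectors without
  case distinctions.\<close>

lemma unit_orthogonal_exists:
  fixes xs :: "'a::euclidean_space list"
  assumes "length xs < DIM('a)"
  obtains r where "r \<bullet> r = 1" "\<And>x. x \<in> set xs \<Longrightarrow> x \<bullet> r = 0"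
proof -
  have "dim (set xs) < DIM('a)"
    using dim_le_card'[of "set xs"] card_length[of xs] assms by simp
  then obtain y where y: "y \<noteq> 0" "\<And>x. x \<in> span (set xs) \<Longrightarrow> orthogonal y x"
    by (rule orthogonal_to_subspace_exists) blast
  have "((1 / norm y) *\<^sub>R y) \<bullet> ((1 / norm y) *\<^sub>R y) = 1"
    using y(1) by (simp add: dot_square_norm power2_eq_square)
  moreover have "x \<bullet> ((1 / norm y) *\<^sub>R y) = 0" if "x \<in> set xs" for x
    using y(2)[OF span_base[OF that]] by (simp add: orthogonal_def inner_commute)
  ultimately show thesis
    using that by blast
qed

text \<open>A form that is \<open>G\<^sub>2\<close>-invariant is constant on orthonormal pairs. Only the invariance under
  the involutions \<open>flip3\<close> is needed, and it enters through the hypothesis \<open>orth\<close>.\<close>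

lemma (in cross7) invariant_form:
  fixes B :: "(real^7^7) set"
  assumes skewB: "\<And>E x y. E \<in> B \<Longrightarrow> (E *v x) \<bullet> y = - ((E *v y) \<bullet> x)"
    and orth: "\<And>a u r. a \<bullet> a = 1 \<Longrightarrow> u \<bullet> u = 1 \<Longrightarrow> a \<bullet> u = 0 \<Longrightarrow> perp a u (X a u) r \<Longrightarrow>
      (\<Sum>E\<in>B. ((E *v a) \<bullet> u) * ((E *v a) \<bullet> r)) = 0"
  shows "\<exists>c. \<forall>a q. (\<Sum>E\<in>B. ((E *v a) \<bullet> q)\<^sup>2) = c * ((a \<bullet> a) * (q \<bullet> q) - (a \<bullet> q)\<^sup>2)"
proof -
  define Q where "Q a q = (\<Sum>E\<in>B. ((E *v a) \<bullet> q)\<^sup>2)" for a q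
  have Q_sym: "Q a q = Q q a" for a q
    unfolding Q_def by (rule sum.cong[OF refl]) (simp add: skewB[of _ a q])
  have step1: "Q a u = Q a r"
    if a: "a \<bullet> a = 1" and u: "u \<bullet> u = 1" "a \<bullet> u = 0" and r: "r \<bullet> r = 1" "perp a u (X a u) r" for a u r
  proof -
    \<comment> \<open>For the rotated pair \<open>w\<close>, \<open>u - r\<close> the mixed product
      in \<open>orth\<close> is a multiple of a difference of squares, so its vanishing equates
      \<open>Q a u\<close> and \<open>Q a r\<close>.\<close>
    define w where "w = (1 / sqrt 2) *\<^sub>R (u + r)"
    have ur: "u \<bullet> r = 0" "a \<bullet> r = 0" "X a u \<bullet> r = 0"
      using r(2) by (auto simp: perp_def)
    have "X a r \<bullet> u = - (X a u \<bullet> r)"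
      using triple_cycle[of u a r] skew[of u a] by simp
    then have "perp a w (X a w) (u - r)"
      using u r ur by (simp add: perp_def w_def X.add_right X.scaleR_right inner_add_left inner_diff_right inner_commute[of r u])
    moreover have "w \<bullet> w = 1" "a \<bullet> w = 0"
      using u r ur by (simp_all add: w_def inner_add_left inner_add_right inner_commute[of r u])
    ultimately have "(\<Sum>E\<in>B. ((E *v a) \<bullet> w) * ((E *v a) \<bullet> (u - r))) = 0"
      using orth[OF a] by blast
    moreover have "((E *v a) \<bullet> w) * ((E *v a) \<bullet> (u - r)) =
        (1 / sqrt 2) * (((E *v a) \<bullet> u)\<^sup>2 - ((E *v a) \<bullet> r)\<^sup>2)" for E
      by (simp add: w_def inner_add_right inner_diff_right power2_eq_square algebra_simps)
    ultimately have "(\<Sum>E\<in>B. (1 / sqrt 2) * (((E *v a) \<bullet> u)\<^sup>2 - ((E *v a) \<bullet> r)\<^sup>2)) = 0"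
      by (simp only:)
    then have "(1 / sqrt 2) * (Q a u - Q a r) = 0"
      unfolding Q_def sum_distrib_left[symmetric] sum_subtractf .
    then show ?thesis by simp
  qed
  have step2: "Q a u = Q a u'"
    if a: "a \<bullet> a = 1" and u: "u \<bullet> u = 1" "a \<bullet> u = 0" and u': "u' \<bullet> u' = 1" "a \<bullet> u' = 0" for a u u'
  proof -
    \<comment> \<open>Five vectors cannot span a space of dimension 7, so one \<open>r\<close> is
      orthogonal to both triples containing \<open>a\<close>.\<close>
    obtain r where "r \<bullet> r = 1" "\<And>x. x \<in> set [a, u, X a u, u', X a u'] \<Longrightarrow> x \<bullet> r = 0"
      by (rule unit_orthogonal_exists[of "[a, u, X a u, u', X a u']"]) auto
    then show ?thesis
      using step1[OF a u, of r] step1[OF a u', of r] by (simp add: perp_def)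
  qed
  have step3: "Q a u = Q a' u'"
    if a: "a \<bullet> a = 1" "u \<bullet> u = 1" "a \<bullet> u = 0" and a': "a' \<bullet> a' = 1" "u' \<bullet> u' = 1" "a' \<bullet> u' = 0" for a u a' u'
  proof -
    \<comment> \<open>The pairs are linked through \<open>s\<close>: change the second entry, then
      the first by symmetry of \<open>Q\<close>, then the second again.\<close>
    obtain s where s: "s \<bullet> s = 1" "a \<bullet> s = 0" "a' \<bullet> s = 0"
      by (rule unit_orthogonal_exists[of "[a, a']"]) auto
    have "Q a u = Q a s"
      by (rule step2[OF a s(1,2)])
    also have "\<dots> = Q a' s"
      unfolding Q_sym[of a s] Q_sym[of a' s]
      by (rule step2) (use s a(1) a'(1) in \<open>simp_all add: inner_commute[of s a] inner_commute[of s a']\<close>)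
    also have "\<dots> = Q a' u'"
      by (rule step2[OF a'(1) s(1,3) a'(2,3)])
    finally show ?thesis .
  qed
  obtain e :: "real^7" where e: "e \<bullet> e = 1"
    by (rule unit_orthogonal_exists[of "[]"]) auto
  obtain f where f: "f \<bullet> f = 1" "e \<bullet> f = 0"
    by (rule unit_orthogonal_exists[of "[e]"]) auto
  have scale: "Q (s *\<^sub>R a) (t *\<^sub>R q) = s\<^sup>2 * t\<^sup>2 * Q a q" for s t a q
    by (simp add: Q_def matrix_vector_mult_scaleR power_mult_distrib mult.assoc flip: sum_distrib_left)
  have "Q a q = Q e f * ((a \<bullet> a) * (q \<bullet> q) - (a \<bullet> q)\<^sup>2)" for a q
  proof (cases "a = 0")
    case True
    then show ?thesis
      by (simp add: Q_def)
  next
    case False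
    \<comment> \<open>The component of \<open>q\<close> orthogonal to \<open>a\<close>.
      \<open>Q\<close> does not see the removed part since \<open>E *v a\<close> is orthogonal to
      \<open>a\<close>, and \<open>w\<close> carries the Gram determinant of \<open>a\<close> and
      \<open>q\<close>.\<close>
    define w where "w = q - ((a \<bullet> q) / (a \<bullet> a)) *\<^sub>R a"
    have aa: "a \<bullet> a \<noteq> 0"
      using False by simp
    have aw: "a \<bullet> w = 0"
      using aa by (simp add: w_def inner_diff_right)
    have ww: "(a \<bullet> a) * (w \<bullet> w) = (a \<bullet> a) * (q \<bullet> q) - (a \<bullet> q)\<^sup>2"
      using aa by (simp add: w_def inner_diff_left inner_diff_right inner_commute[of q a] power2_eq_square field_simps)
    have "(E *v a) \<bullet> a = 0" if "E \<in> B" for E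
      using skewB[OF that, of a a] by simp
    then have Qw: "Q a q = Q a w"
      unfolding Q_def by (intro sum.cong refl) (simp add: w_def inner_diff_right)
    show ?thesis
    proof (cases "w = 0")
      case True
      then show ?thesis
        using Qw ww by (simp add: Q_def)
    next
      case False
      have "Q (norm a *\<^sub>R ((1 / norm a) *\<^sub>R a)) (norm w *\<^sub>R ((1 / norm w) *\<^sub>R w)) =
          (norm a)\<^sup>2 * (norm w)\<^sup>2 * Q ((1 / norm a) *\<^sub>R a) ((1 / norm w) *\<^sub>R w)"
        by (rule scale)
      moreover have "Q ((1 / norm a) *\<^sub>R a) ((1 / norm w) *\<^sub>R w) = Q e f"
        using False \<open>a \<noteq> 0\<close> aw by (intro step3 e f) (simp_all add: dot_square_norm power2_eq_square)
      ultimately have "Q a w = (norm a)\<^sup>2 * (norm w)\<^sup>2 * Q e f"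
        using False \<open>a \<noteq> 0\<close> by simp
      then show ?thesis
        using Qw ww by (simp add: dot_square_norm mult.commute)
    qed
  qed
  then show ?thesis
    unfolding Q_def by blast
qed

text \<open>Polarisation in \<open>q\<close>, then in \<open>a\<close>. The quartic form determines
  only the part symmetric in \<open>q\<close> and \<open>r\<close>; this suffices for
  \<open>casimir\<close>, where \<open>q = r\<close>, and for squares of one complex vector
  \<open>p\<close>, where both mixed sums occur together.\<close>

lemma invariant_form_polarised:
  fixes B :: "(real^'n^'n) set"
  assumes "\<And>a q. (\<Sum>E\<in>B. ((E *v a) \<bullet> q)\<^sup>2) = c * ((a \<bullet> a) * (q \<bullet> q) - (a \<bullet> q)\<^sup>2)"
  shows "(\<Sum>E\<in>B. ((E *v a) \<bullet> q) * ((E *v b) \<bullet> r)) + (\<Sum>E\<in>B. ((E *v a) \<bullet> r) * ((E *v b) \<bullet> q)) =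
    c * (2 * (a \<bullet> b) * (q \<bullet> r) - (a \<bullet> q) * (b \<bullet> r) - (a \<bullet> r) * (b \<bullet> q))"
proof -
  have 1: "(\<Sum>E\<in>B. ((E *v a) \<bullet> q) * ((E *v a) \<bullet> r)) = c * ((a \<bullet> a) * (q \<bullet> r) - (a \<bullet> q) * (a \<bullet> r))" for a q r
  proof -
    have "(\<Sum>E\<in>B. ((E *v a) \<bullet> (q + r))\<^sup>2) = (\<Sum>E\<in>B. ((E *v a) \<bullet> q)\<^sup>2) + (\<Sum>E\<in>B. ((E *v a) \<bullet> r)\<^sup>2) +
        2 * (\<Sum>E\<in>B. ((E *v a) \<bullet> q) * ((E *v a) \<bullet> r))"
      by (simp add: inner_add_right power2_sum sum.distrib sum_distrib_left mult.assoc)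
    then show ?thesis
      unfolding assms by (simp add: inner_add_left inner_add_right inner_commute[of r q] power2_eq_square algebra_simps)
  qed
  have "(\<Sum>E\<in>B. ((E *v (a + b)) \<bullet> q) * ((E *v (a + b)) \<bullet> r)) =
      (\<Sum>E\<in>B. ((E *v a) \<bullet> q) * ((E *v a) \<bullet> r)) + (\<Sum>E\<in>B. ((E *v b) \<bullet> q) * ((E *v b) \<bullet> r)) +
      ((\<Sum>E\<in>B. ((E *v a) \<bullet> q) * ((E *v b) \<bullet> r)) + (\<Sum>E\<in>B. ((E *v a) \<bullet> r) * ((E *v b) \<bullet> q)))"
    by (simp add: matrix_vector_right_distrib inner_add_left algebra_simps flip: sum.distrib)
  then show ?thesis
    unfolding 1 by (simp add: inner_add_left inner_add_right inner_commute[of b a] algebra_simps)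
qed

text \<open>Skewness turns the square into minus the sum of <Ea,Eb>. Expanded over the standard
  basis, the polarised form contributes n<a,b> - <a,b>, hence the factor n - 1.\<close>

lemma casimir:
  fixes B :: "(real^'n^'n) set"
  assumes skewB: "\<And>E x y. E \<in> B \<Longrightarrow> (E *v x) \<bullet> y = - ((E *v y) \<bullet> x)"
    and form: "\<And>a q. (\<Sum>E\<in>B. ((E *v a) \<bullet> q)\<^sup>2) = c * ((a \<bullet> a) * (q \<bullet> q) - (a \<bullet> q)\<^sup>2)"
  shows "(\<Sum>E\<in>B. E ** E) = (- c * (real CARD('n) - 1)) *\<^sub>R mat 1"
proof -
  have lin: "linear (\<lambda>A :: real^'n^'n. A *v a)" for a
    by (rule linearI) (simp_all add: matrix_vector_mult_add_rdistrib scaleR_matrix_vector_assoc)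
  have "(\<Sum>E\<in>B. E ** E) *v a = ((- c * (real CARD('n) - 1)) *\<^sub>R mat 1) *v a" for a
  proof (rule vector_eq_rdot[THEN iffD1, rule_format])
    fix b
    have diag: "(\<Sum>E\<in>B. ((E *v a) \<bullet> i) * ((E *v b) \<bullet> i)) = c * (a \<bullet> b - (a \<bullet> i) * (b \<bullet> i))"
      if "i \<in> Basis" for i
      using invariant_form_polarised[OF form, of a i b i] that by (simp add: algebra_simps)
    have "((\<Sum>E\<in>B. E ** E) *v a) \<bullet> b = (\<Sum>E\<in>B. (E *v (E *v a)) \<bullet> b)"
      by (simp add: linear_sum[OF lin] inner_sum_left matrix_vector_mul_assoc)
    also have "\<dots> = (\<Sum>E\<in>B. - ((E *v a) \<bullet> (E *v b)))"
    proof (rule sum.cong[OF refl])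
      fix E assume "E \<in> B"
      then show "(E *v (E *v a)) \<bullet> b = - ((E *v a) \<bullet> (E *v b))"
        using skewB[of E "E *v a" b] by (simp add: inner_commute)
    qed
    also have "\<dots> = - (\<Sum>i\<in>Basis. \<Sum>E\<in>B. ((E *v a) \<bullet> i) * ((E *v b) \<bullet> i))"
      by (subst sum.swap) (simp add: sum_negf euclidean_inner[of "E *v a" "E *v b" for E])
    also have "\<dots> = - (\<Sum>i\<in>Basis. c * (a \<bullet> b - (a \<bullet> i) * (b \<bullet> i)))"
      by (simp add: diag)
    also have "\<dots> = - (c * (real CARD('n) * (a \<bullet> b) - a \<bullet> b))"
      by (simp add: sum_subtractf euclidean_inner[of a b] flip: sum_distrib_left)
    finally show "((\<Sum>E\<in>B. E ** E) *v a) \<bullet> b = (((- c * (real CARD('n) - 1)) *\<^sub>R mat 1) *v a) \<bullet> b"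
      by (simp add: algebra_simps flip: scaleR_matrix_vector_assoc)
  qed
  then show ?thesis
    by (simp add: matrix_eq)
qed

section \<open>Complexification\<close>

definition re_vec :: "complex^'n \<Rightarrow> real^'n" where
  "re_vec a = (\<chi> i. Re (a $ i))"

definition im_vec :: "complex^'n \<Rightarrow> real^'n" where
  "im_vec a = (\<chi> i. Im (a $ i))"

lemma cbilin_re_im:
  "cbilin a b = Complex (re_vec a \<bullet> re_vec b - im_vec a \<bullet> im_vec b) (re_vec a \<bullet> im_vec b + im_vec a \<bullet> re_vec b)"
  by (simp add: cbilin_def complex_eq_iff re_vec_def im_vec_def inner_vec_def sum_subtractf sum.distrib)

lemma rho_re_im: "re_vec (rho A a) = A *v re_vec a" "im_vec (rho A a) = A *v im_vec a"
  by (simp_all add: rho_def re_vec_def im_vec_def matrix_vector_mult_def vec_eq_iff)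

lemma rho_mult: "rho (A ** C) a = rho A (rho C a)"
proof -
  have "re_vec (rho (A ** C) a) = re_vec (rho A (rho C a))" "im_vec (rho (A ** C) a) = im_vec (rho A (rho C a))"
    by (simp_all add: rho_re_im matrix_vector_mul_assoc)
  then show ?thesis
    by (simp add: re_vec_def im_vec_def vec_eq_iff complex_eq_iff)
qed

lemma rho_one: "rho (mat 1) a = a"
proof -
  have "re_vec (rho (mat 1) a) = re_vec a" "im_vec (rho (mat 1) a) = im_vec a"
    by (simp_all add: rho_re_im)
  then show ?thesis
    by (simp add: re_vec_def im_vec_def vec_eq_iff complex_eq_iff)
qed

lemma cbilin_rho: "cbilin (rho A a) b = cbilin a (rho (transpose A) b)"
proof -
  have "(A *v x) \<bullet> y = x \<bullet> (transpose A *v y)" for x y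
    using dot_lmul_matrix[of y A x] by (simp add: inner_commute)
  then show ?thesis
    by (simp add: cbilin_re_im rho_re_im del: transpose_matrix_vector)
qed

lemma bounded_linear_phi: "bounded_linear (phi a p)"
  unfolding linear_conv_bounded_linear[symmetric]
  by (rule linearI) (simp_all add: phi_def cbilin_re_im rho_re_im complex_eq_iff inner_add_left inner_diff_left
      matrix_vector_mult_add_rdistrib algebra_simps flip: scaleR_matrix_vector_assoc)

text \<open>Isotropy means that the real and imaginary parts of \<open>p\<close> are orthogonal and
  equally long. The terms with the factor <a,b> then cancel and only products survive.\<close>

lemma invariant_form_complex:
  fixes B :: "(real^'n^'n) set"
  assumes form: "\<And>a q. (\<Sum>E\<in>B. ((E *v a) \<bullet> q)\<^sup>2) = c * ((a \<bullet> a) * (q \<bullet> q) - (a \<bullet> q)\<^sup>2)"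
    and p: "cbilin p p = 0"
  shows "(\<Sum>E\<in>B. cbilin (rho E a) p * cbilin (rho E b) p) = of_real (- c) * cbilin a p * cbilin b p"
proof -
  define f where "f = (\<lambda>v. Complex (v \<bullet> re_vec p) (v \<bullet> im_vec p))"
  have pp: "re_vec p \<bullet> re_vec p = im_vec p \<bullet> im_vec p" "re_vec p \<bullet> im_vec p = 0"
    using p by (auto simp: cbilin_re_im complex_eq_iff inner_commute[of "im_vec p" "re_vec p"])
  note P = invariant_form_polarised[OF form]
  have real: "(\<Sum>E\<in>B. f (E *v v) * f (E *v w)) = of_real (- c) * f v * f w" for v w
  proof (rule complex_eqI)
    have "Re (\<Sum>E\<in>B. f (E *v v) * f (E *v w)) =
        (\<Sum>E\<in>B. ((E *v v) \<bullet> re_vec p) * ((E *v w) \<bullet> re_vec p)) - (\<Sum>E\<in>B. ((E *v v) \<bullet> im_vec p) * ((E *v w) \<bullet> im_vec p))"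
      by (simp add: f_def sum_subtractf)
    also have "\<dots> = Re (of_real (- c) * f v * f w)"
      using P[of v "re_vec p" w "re_vec p"] P[of v "im_vec p" w "im_vec p"] pp
      by (simp add: f_def algebra_simps)
    finally show "Re (\<Sum>E\<in>B. f (E *v v) * f (E *v w)) = Re (of_real (- c) * f v * f w)" .
    have "Im (\<Sum>E\<in>B. f (E *v v) * f (E *v w)) =
        (\<Sum>E\<in>B. ((E *v v) \<bullet> re_vec p) * ((E *v w) \<bullet> im_vec p)) + (\<Sum>E\<in>B. ((E *v v) \<bullet> im_vec p) * ((E *v w) \<bullet> re_vec p))"
      by (simp add: f_def sum.distrib)
    also have "\<dots> = Im (of_real (- c) * f v * f w)"
      unfolding P using pp by (simp add: f_def algebra_simps)
    finally show "Im (\<Sum>E\<in>B. f (E *v v) * f (E *v w)) = Im (of_real (- c) * f v * f w)" .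
  qed
  \<comment> \<open>\<open>f\<close> is the pairing of a real vector with \<open>p\<close>; the
    identity for real vectors extends to complex ones by bilinearity.\<close>
  have cf: "cbilin x p = f (re_vec x) + \<i> * f (im_vec x)" for x
    by (simp add: cbilin_re_im f_def complex_eq_iff)
  have "(\<Sum>E\<in>B. cbilin (rho E a) p * cbilin (rho E b) p) =
      (\<Sum>E\<in>B. f (E *v re_vec a) * f (E *v re_vec b)) + \<i> * (\<Sum>E\<in>B. f (E *v re_vec a) * f (E *v im_vec b)) +
      \<i> * (\<Sum>E\<in>B. f (E *v im_vec a) * f (E *v re_vec b)) - (\<Sum>E\<in>B. f (E *v im_vec a) * f (E *v im_vec b))"
    by (simp add: cf rho_re_im sum_distrib_left algebra_simps flip: sum.distrib sum_subtractf)
  also have "\<dots> = of_real (- c) * cbilin a p * cbilin b p"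
    unfolding real cf by (simp add: algebra_simps)
  finally show ?thesis .
qed

section \<open>The eigenfamily\<close>

theorem theorem1p1:
  fixes X :: "real^7 \<Rightarrow> real^7 \<Rightarrow> real^7"
    and g :: "real^7^7 \<Rightarrow> real^7^7 \<Rightarrow> real^7^7 \<Rightarrow> real"
    and p :: "complex^7"
  assumes "cross_product7 X"
    and "riemannian_metric (G2 X) g"
    and "bi_invariant (G2 X) g"
    and "cbilin p p = 0"
  shows "eigenfamily (G2 X) g {phi a p | a. True}"
proof -
  interpret cross7 X
    by unfold_locales fact
  interpret bi_invariant_group "G2 X" g
    using assms(2,3) G2_group[where X = X] by unfold_locales auto
  obtain B where B: "ortho_basis ip lie B"
    using ortho_basis_lie_exists ..
  have skewB: "(E *v x) \<bullet> y = - ((E *v y) \<bullet> x)" if "E \<in> B" for E x y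
    using ortho_basis_subset[OF B] that by (intro lie_inner_skew) auto
  \<comment> \<open>Conjugation by the involution \<open>k\<close> preserves the sum, yet each
    summand changes sign because \<open>k\<close> fixes \<open>a\<close> and \<open>u\<close> and
    negates \<open>r\<close>.\<close>
  have "(\<Sum>E\<in>B. ((E *v a) \<bullet> u) * ((E *v a) \<bullet> r)) = 0"
    if "a \<bullet> a = 1" "u \<bullet> u = 1" "a \<bullet> u = 0" and r: "perp a u (X a u) r" for a u r
  proof -
    define k where "k = flip3 a u (X a u)"
    have T: "triple a u (X a u)"
      using that(1-3) by (rule tripleI)
    have K: "matrix k \<in> G2 X"
      unfolding k_def by (rule flip3_in_G2[OF T])
    have Kv: "matrix k *v v = k v" for v
      unfolding k_def by (simp add: matrix_works linear_flip3)
    have k: "k a = a" "k u = u" "k r = - r"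
      unfolding k_def using flip3_fix[OF T] flip3_perp[OF r] by auto
    \<comment> \<open>The transpose is the inverse, and \<open>k\<close> is its own inverse.\<close>
    have Kt: "transpose (matrix k) *v v = k v" for v
    proof -
      have "transpose (matrix k) *v (matrix k *v k v) = k v"
        using K by (simp add: matrix_vector_mul_assoc del: transpose_matrix_vector)
      moreover have "k (k v) = v"
        using T by (simp add: k_def flip3_def triple_def inner_add_right inner_diff_right inner_commute algebra_simps)
      ultimately show ?thesis
        by (simp add: Kv del: transpose_matrix_vector)
    qed
    have conj: "((matrix k ** E ** transpose (matrix k)) *v v) \<bullet> w = (E *v k v) \<bullet> k w" for E v w
    proof -
      have "((matrix k ** E ** transpose (matrix k)) *v v) \<bullet> w = (matrix k *v (E *v k v)) \<bullet> w"
        by (simp add: Kt flip: matrix_vector_mul_assoc del: transpose_matrix_vector)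
      also have "\<dots> = (E *v k v) \<bullet> (transpose (matrix k) *v w)"
        using dot_lmul_matrix[of w "matrix k" "E *v k v"] by (simp add: inner_commute)
      finally show ?thesis
        by (simp add: Kt del: transpose_matrix_vector)
    qed
    have "bounded_bilinear (\<lambda>E F. ((E *v a) \<bullet> u) * ((F *v a) \<bullet> r))"
      unfolding bilinear_conv_bounded_bilinear[symmetric] bilinear_def
      by (auto intro!: linearI simp: matrix_vector_mult_add_rdistrib inner_add_left algebra_simps
          simp flip: scaleR_matrix_vector_assoc)
    from sum_conjugate[OF K B this] show ?thesis
      by (simp add: conj k sum_negf)
  qed
  from invariant_form[OF skewB this]
  obtain c where c: "\<And>a q. (\<Sum>E\<in>B. ((E *v a) \<bullet> q)\<^sup>2) = c * ((a \<bullet> a) * (q \<bullet> q) - (a \<bullet> q)\<^sup>2)"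
    by blast
  have lap: "laplacian (G2 X) g (phi a p) x = of_real (- 6 * c) * phi a p x" if x: "x \<in> G2 X" for a x
  proof -
    interpret phi: bounded_linear "phi a p"
      by (rule bounded_linear_phi)
    have "laplacian (G2 X) g (phi a p) x = phi a p (x ** (\<Sum>E\<in>B. E ** E))"
      by (simp add: laplacian_linear[OF B bounded_linear_phi x] mm.sum_right phi.sum matrix_mul_assoc)
    \<comment> \<open>The factor in \<open>casimir\<close> is \<open>7 - 1\<close>.\<close>
    also have "\<dots> = of_real (- 6 * c) * phi a p x"
      by (simp add: casimir[OF skewB c] mm.scaleR_right mm.minus_right phi.scaleR phi.neg scaleR_conv_of_real[of _ "phi a p x"])
    finally show ?thesis .
  qed
  have conf: "conformality (G2 X) g (phi a p) (phi b p) x = of_real (- c) * phi a p x * phi b p x"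
    if x: "x \<in> G2 X" for a b x
  proof -
    \<comment> \<open>Moving \<open>x\<close> to the other argument reduces the claim to the
      identity element; \<open>q\<close> is again isotropic since \<open>x\<close> is
      orthogonal.\<close>
    define q where "q = rho (transpose x) p"
    have phi_q: "phi a p (x ** E) = cbilin (rho E a) q" for a E
      by (simp add: phi_def q_def rho_mult cbilin_rho[of x])
    have "cbilin q q = cbilin (rho (transpose x) p) (rho (transpose x) p)"
      by (simp add: q_def)
    also have "\<dots> = cbilin p (rho (x ** transpose x) p)"
      by (simp add: cbilin_rho[of "transpose x"] rho_mult)
    finally have "cbilin q q = 0"
      using x assms(4) by (simp add: rho_one)
    from invariant_form_complex[OF c this, of a b]
    show ?thesis
      \<comment> \<open>With \<open>E = mat 1\<close> the right-hand side \<open>cbilin a q\<close>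
        becomes \<open>phi a p x\<close>.\<close>
      using phi_q[of _ "mat 1"]
      by (simp add: conformality_linear[OF B bounded_linear_phi bounded_linear_phi x] phi_q rho_one)
  qed
  show ?thesis
    unfolding eigenfamily_def
  proof (intro conjI ballI)
    fix \<phi> assume "\<phi> \<in> {phi a p | a. True}"
    then show "smooth_map (G2 X) \<phi>"
      using smooth_map_linear[OF bounded_linear_phi] by blast
  next
    show "\<exists>lam mu :: real. \<forall>\<phi>\<in>{phi a p | a. True}. \<forall>\<psi>\<in>{phi a p | a. True}. \<forall>x\<in>G2 X.
        laplacian (G2 X) g \<phi> x = of_real lam * \<phi> x \<and>
        conformality (G2 X) g \<phi> \<psi> x = of_real mu * \<phi> x * \<psi> x"
      by (rule exI[of _ "- 6 * c"], rule exI[of _ "- c"]) (use lap conf in blast)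
  qed
qed

end
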